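(* Let $k$ be a field, let $H$ be a Hopf algebra over $k$ with bijective antipode $S$, let $C$ be a left $H$-module coalgebra, and let $M$ be a stable left-right anti-Yetter-Drinfeld contramodule over $H$ with contramodule structure map $\alpha:\mathrm{Hom}(H,M)\to M$. For all integers $n\ge 0$ let $C_n^H(C,M):=\mathrm{Hom}_H(C^{\otimes n+1},M)$ be the space of left $H$-linear maps, where $C^{\otimes n+1}$ is a left $H$-module by the diagonal action. Define maps $d_i: C_n^H(C,M)\to C_{n-1}^H(C,M)$ ($0\le i\le n$, $n\geq 1$), $s_j: C_n^H(C,M)\to C_{n+1}^H(C,M)$ ($0\le j\le n$) and $t_n: C_n^H(C,M)\to C_n^H(C,M)$ by $$d_i(f)(c^0,\ldots,c^{n-1}) = f(c^0,\ldots,\Delta_C(c^i),\ldots,c^{n-1}),\qquad 0\le i<n,$$ $$d_n(f)(c^0,\ldots,c^{n-1}) = \alpha\left(f\left(c^0_{(2)},c^1,\ldots,c^{n-1},(-)\cdot c^0_{(1)}\right)\right),$$ $$s_j(f)(c^0,\ldots,c^{n+1}) = \varepsilon_C(c^{j+1})\,f(c^0,\ldots,c^j,c^{j+2},\ldots,c^{n+1}),$$ $$t_n(f)(c^0,\ldots,c^n) = \alpha\left(f\left(c^1,\ldots,c^n,(-)\cdot c^0\right)\right).$$ Then $C_*^H(C,M)$ with these $d_i$, $s_j$, $t_n$ is a cyclic module.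
   Context: All algebras are associative and unital and all coalgebras are coassociative and counital over the field $k$. $\mathrm{Hom}(V,W)$ denotes the space of $k$-linear maps. Sweedler notation is used: $\Delta(c)=c_{(1)}\otimes c_{(2)}$, etc., with summation implicit. A linear map on $C^{\otimes n+1}$ is written as a function of $n+1$ arguments; $f(c^0,\ldots,\Delta_C(c^i),\ldots,c^{n-1})$ means $f(c^0,\ldots,c^i_{(1)},c^i_{(2)},\ldots,c^{n-1})$. The symbol $(-)$ denotes the free argument in $H$: $\alpha(g(-))$ means $\alpha$ applied to the linear map $h'\mapsto g(h')$. Left $H$-module coalgebra: a coalgebra $C$ that is a left $H$-module with $\Delta_C(h\cdot c)=h_{(1)}\cdot c_{(1)}\otimes h_{(2)}\cdot c_{(2)}$ and $\varepsilon_C(h\cdot c)=\varepsilon_H(h)\varepsilon_C(c)$ for all $h\in H$, $c\in C$. The diagonal action on $C^{\otimes n+1}$ is $h\cdot(c^0\otimes\cdots\otimes c^n)=h_{(1)}\cdot c^0\otimes h_{(2)}\cdot c^1\otimes\cdots\otimes h_{(n+1)}\cdot c^n$. Right contramodule of a coalgebra $D$: a vector space $M$ with a $k$-linear map $\alpha:\mathrm{Hom}(D,M)\to M$ such that, for all $f\in\mathrm{Hom}(D\otimes D,M)$ and $m\in M$, $$\alpha\big(x\mapsto \alpha(y\mapsto f(x\otimes y))\big)=\alpha\big(x\mapsto f(x_{(1)}\otimes x_{(2)})\big),\qquad \alpha\big(x\mapsto\varepsilon_D(x)m\big)=m.$$ Left-right anti-Yetter-Drinfeld contramodule over $H$: a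 vector space $M$ that is a left $H$-module and a right $H$-contramodule (over the coalgebra $H$) with structure map $\alpha$, such that for all $h\in H$ and $f\in\mathrm{Hom}(H,M)$, $$h\cdot\alpha(f)=\alpha\big(h'\mapsto h_{(2)}\cdot f(S(h_{(3)})\,h'\,h_{(1)})\big).$$ It is stable if $\alpha(r_m)=m$ for all $m\in M$, where $r_m:H\to M$, $h\mapsto h\cdot m$. Cyclic module: a simplicial $k$-vector space (faces $d_i$, degeneracies $s_j$ satisfying the usual simplicial identities) with linear maps $t_n$ in each degree $n\ge0$ such that $d_it_n=t_{n-1}d_{i-1}$ for $1\le i\le n$, $d_0t_n=d_n$, $s_it_n=t_{n+1}s_{i-1}$ for $1\le i\le n$, $s_0t_n=t_{n+1}^2s_n$, and $t_n^{n+1}=\mathrm{id}$. *)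

theory Defs
  imports
    Complex_Main
    "HOL-Library.Poly_Mapping"
    "HOL-Library.Function_Algebras"
begin

section \<open>Tensor powers of a vector space\<close>

text \<open>
  A vector space is a full type together with a scalar multiplication satisfying
  \<^locale>\<open>vector_space\<close>. Its tensor power \<open>V\<^sup>\<otimes>\<^sup>n\<close> is the
  quotient of the free vector space on \<open>V\<^sup>n\<close> (lists of length \<open>n\<close>)
  by the subspace spanned by the multilinearity relations. The quotient depends on the scalar
  multiplication, which is a term; so it is a carrier set of cosets and not a type.
\<close>

definition free_scale :: "'k::field \<Rightarrow> ('b \<Rightarrow>\<^sub>0 'k) \<Rightarrow> ('b \<Rightarrow>\<^sub>0 'k)" where
  "free_scale c p = Poly_Mapping.map ((*) c) p"

lemma lookup_free_scale [simp]:
  "Poly_Mapping.lookup (free_scale c p) x = c * Poly_Mapping.lookup p x"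
  by (simp add: free_scale_def Poly_Mapping.map.rep_eq when_def)

lemma vector_space_free_scale: "vector_space free_scale"
  by unfold_locales (auto intro!: poly_mapping_eqI simp: lookup_add algebra_simps)

type_synonym ('k, 'v) tensor = "('v list \<Rightarrow>\<^sub>0 'k) set"

definition words :: "nat \<Rightarrow> ('v list \<Rightarrow>\<^sub>0 'k::field) set" where
  "words n = {p. \<forall>xs \<in> Poly_Mapping.keys p. length xs = n}"

definition tensor_relations ::
  "('k::field \<Rightarrow> 'v::ab_group_add \<Rightarrow> 'v) \<Rightarrow> nat \<Rightarrow> ('v list \<Rightarrow>\<^sub>0 'k) set" where
  "tensor_relations s n =
     {Poly_Mapping.single (xs @ (a + b) # ys) 1
        - Poly_Mapping.single (xs @ a # ys) 1 - Poly_Mapping.single (xs @ b # ys) 1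
      | xs a b ys. length xs + length ys + 1 = n} \<union>
     {Poly_Mapping.single (xs @ s c a # ys) 1
        - free_scale c (Poly_Mapping.single (xs @ a # ys) 1)
      | xs c a ys. length xs + length ys + 1 = n}"

definition tensor_class ::
  "('k::field \<Rightarrow> 'v::ab_group_add \<Rightarrow> 'v) \<Rightarrow> nat \<Rightarrow> ('v list \<Rightarrow>\<^sub>0 'k) \<Rightarrow> ('k, 'v) tensor" where
  "tensor_class s n p = {q \<in> words n. q - p \<in> module.span free_scale (tensor_relations s n)}"

definition tensor_power ::
  "('k::field \<Rightarrow> 'v::ab_group_add \<Rightarrow> 'v) \<Rightarrow> nat \<Rightarrow> ('k, 'v) tensor set" where
  "tensor_power s n = tensor_class s n ` words n"

definition tensor_add ::
  "('k::field \<Rightarrow> 'v::ab_group_add \<Rightarrow> 'v) \<Rightarrow> nat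
    \<Rightarrow> ('k, 'v) tensor \<Rightarrow> ('k, 'v) tensor \<Rightarrow> ('k, 'v) tensor" where
  "tensor_add s n u v = (\<Union>p\<in>u. \<Union>q\<in>v. tensor_class s n (p + q))"

definition tensor_scale ::
  "('k::field \<Rightarrow> 'v::ab_group_add \<Rightarrow> 'v) \<Rightarrow> nat
    \<Rightarrow> 'k \<Rightarrow> ('k, 'v) tensor \<Rightarrow> ('k, 'v) tensor" where
  "tensor_scale s n c u = (\<Union>p\<in>u. tensor_class s n (free_scale c p))"

text \<open>\<open>pure s [x\<^sub>1, \<dots>, x\<^sub>n]\<close> is \<open>x\<^sub>1 \<otimes> \<dots> \<otimes> x\<^sub>n\<close>.\<close>

definition pure ::
  "('k::field \<Rightarrow> 'v::ab_group_add \<Rightarrow> 'v) \<Rightarrow> 'v list \<Rightarrow> ('k, 'v) tensor" where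
  "pure s xs = tensor_class s (length xs) (Poly_Mapping.single xs 1)"

text \<open>
  The sum \<open>\<Sum>\<^sub>i c\<^sub>i \<phi>(x\<^sub>i)\<close> for a tensor
  \<open>u = \<Sum>\<^sub>i c\<^sub>i x\<^sub>i\<close> with words \<open>x\<^sub>i\<close>. It is independent of the
  chosen representative when \<open>\<phi>\<close> is multilinear (\<open>tensor_lift_class\<close>
  below). With \<open>u = \<Delta>(x)\<close> it is the sum that Sweedler notation leaves implicit;
  the word \<open>xs\<close> then holds \<open>x\<^sub>(\<^sub>1\<^sub>)\<close> as \<open>xs ! 0\<close>,
  \<open>x\<^sub>(\<^sub>2\<^sub>)\<close> as \<open>xs ! 1\<close>, and so on.
\<close>

definition tensor_lift ::
  "('k::field \<Rightarrow> 'm::ab_group_add \<Rightarrow> 'm) \<Rightarrow> ('v list \<Rightarrow> 'm) \<Rightarrow> ('k, 'v) tensor \<Rightarrow> 'm" where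
  "tensor_lift sM \<phi> u =
     (let p = (SOME p. p \<in> u)
      in \<Sum>xs\<in>Poly_Mapping.keys p. sM (Poly_Mapping.lookup p xs) (\<phi> xs))"

text \<open>The same for \<open>\<phi>\<close> with values in \<open>W\<^sup>\<otimes>\<^sup>n\<close>, which is not a type.\<close>

definition tensor_lift_tensor ::
  "('k::field \<Rightarrow> 'w::ab_group_add \<Rightarrow> 'w) \<Rightarrow> nat
    \<Rightarrow> ('v list \<Rightarrow> ('k, 'w) tensor) \<Rightarrow> ('k, 'v) tensor \<Rightarrow> ('k, 'w) tensor" where
  "tensor_lift_tensor s n \<phi> u =
     tensor_class s n (tensor_lift free_scale (\<lambda>xs. SOME p. p \<in> \<phi> xs) u)"

text \<open>
  Linear maps \<open>V\<^sup>\<otimes>\<^sup>n \<rightarrow> M\<close>, made extensional by the value \<open>0\<close>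
  off the carrier.
\<close>

definition tensor_hom ::
  "('k::field \<Rightarrow> 'v::ab_group_add \<Rightarrow> 'v) \<Rightarrow> nat \<Rightarrow> ('k \<Rightarrow> 'm::ab_group_add \<Rightarrow> 'm)
    \<Rightarrow> (('k, 'v) tensor \<Rightarrow> 'm) set" where
  "tensor_hom s n sM =
     {f. (\<forall>u \<in> tensor_power s n. \<forall>v \<in> tensor_power s n. f (tensor_add s n u v) = f u + f v) \<and>
         (\<forall>c. \<forall>u \<in> tensor_power s n. f (tensor_scale s n c u) = sM c (f u)) \<and>
         (\<forall>u. u \<notin> tensor_power s n \<longrightarrow> f u = 0)}"

text \<open>
  The linear map on \<open>V\<^sup>\<otimes>\<^sup>n\<close> given on
  \<open>x\<^sub>1 \<otimes> \<dots> \<otimes> x\<^sub>n\<close> by a multilinear expression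
  \<open>\<phi> [x\<^sub>1, \<dots>, x\<^sub>n]\<close>.
\<close>

definition tensor_fun ::
  "('k::field \<Rightarrow> 'v::ab_group_add \<Rightarrow> 'v) \<Rightarrow> nat \<Rightarrow> ('k \<Rightarrow> 'm::ab_group_add \<Rightarrow> 'm)
    \<Rightarrow> ('v list \<Rightarrow> 'm) \<Rightarrow> ('k, 'v) tensor \<Rightarrow> 'm" where
  "tensor_fun s n sM \<phi> = (\<lambda>u. if u \<in> tensor_power s n then tensor_lift sM \<phi> u else 0)"

definition free_eval ::
  "('k::field \<Rightarrow> 'm::ab_group_add \<Rightarrow> 'm) \<Rightarrow> ('v list \<Rightarrow> 'm) \<Rightarrow> ('v list \<Rightarrow>\<^sub>0 'k) \<Rightarrow> 'm" where
  "free_eval sM \<phi> p = (\<Sum>xs\<in>Poly_Mapping.keys p. sM (Poly_Mapping.lookup p xs) (\<phi> xs))"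

lemma free_eval_superset:
  assumes "vector_space sM" "finite A" "Poly_Mapping.keys p \<subseteq> A"
  shows "free_eval sM \<phi> p = (\<Sum>xs\<in>A. sM (Poly_Mapping.lookup p xs) (\<phi> xs))"
proof -
  interpret vector_space sM by fact
  show ?thesis
    unfolding free_eval_def
    by (rule sum.mono_neutral_left) (use assms in \<open>auto simp: in_keys_iff\<close>)
qed

lemma linear_free_eval:
  assumes "vector_space sM"
  shows "Vector_Spaces.linear free_scale sM (free_eval sM \<phi>)"
proof -
  interpret M: vector_space sM by fact
  interpret F: vector_space free_scale by (rule vector_space_free_scale)
  have add: "free_eval sM \<phi> (p + q) = free_eval sM \<phi> p + free_eval sM \<phi> q" for p q
  proof -
    let ?A = "Poly_Mapping.keys p \<union> Poly_Mapping.keys q"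
    have A: "finite ?A" "Poly_Mapping.keys p \<subseteq> ?A" "Poly_Mapping.keys q \<subseteq> ?A"
      "Poly_Mapping.keys (p + q) \<subseteq> ?A"
      using Poly_Mapping.keys_add[of p q] by auto
    show ?thesis
      by (simp add: free_eval_superset[OF assms A(1)] A lookup_add M.scale_left_distrib sum.distrib)
  qed
  have scale: "free_eval sM \<phi> (free_scale c p) = sM c (free_eval sM \<phi> p)" for c p
  proof -
    let ?A = "Poly_Mapping.keys p"
    have A: "finite ?A" "Poly_Mapping.keys (free_scale c p) \<subseteq> ?A"
      by (auto simp: in_keys_iff)
    show ?thesis
      by (simp add: free_eval_superset[OF assms A(1)] A M.scale_sum_right)
  qed
  show ?thesis
    by unfold_locales (auto simp: add scale)
qed

lemma free_eval_single:
  assumes "vector_space sM"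
  shows "free_eval sM \<phi> (Poly_Mapping.single xs c) = sM c (\<phi> xs)"
proof -
  interpret vector_space sM by fact
  show ?thesis
    by (subst free_eval_superset[OF assms, of "{xs}"]) auto
qed

lemma tensor_lift_class:
  assumes sM: "vector_space sM"
    and lin: "\<And>xs ys. length xs + length ys + 1 = n \<Longrightarrow>
                Vector_Spaces.linear s sM (\<lambda>a. \<phi> (xs @ a # ys))"
    and p: "p \<in> words n"
  shows "tensor_lift sM \<phi> (tensor_class s n p) = free_eval sM \<phi> p"
proof -
  interpret M: vector_space sM by fact
  interpret F: vector_space free_scale by (rule vector_space_free_scale)
  interpret E: Vector_Spaces.linear free_scale sM "free_eval sM \<phi>"
    by (rule linear_free_eval[OF sM])
  have rel: "free_eval sM \<phi> r = 0" if "r \<in> tensor_relations s n" for r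
  proof -
    from that consider
      (add) xs a b ys where "length xs + length ys + 1 = n"
        "r = Poly_Mapping.single (xs @ (a + b) # ys) 1
          - Poly_Mapping.single (xs @ a # ys) 1 - Poly_Mapping.single (xs @ b # ys) 1"
    | (scale) xs c a ys where "length xs + length ys + 1 = n"
        "r = Poly_Mapping.single (xs @ s c a # ys) 1
          - free_scale c (Poly_Mapping.single (xs @ a # ys) 1)"
      unfolding tensor_relations_def by blast
    then show ?thesis
    proof cases
      case add
      interpret L: Vector_Spaces.linear s sM "\<lambda>a. \<phi> (xs @ a # ys)" by (rule lin[OF add(1)])
      show ?thesis by (simp add: add(2) E.diff free_eval_single[OF sM] L.add)
    next
      case scale
      interpret L: Vector_Spaces.linear s sM "\<lambda>a. \<phi> (xs @ a # ys)" by (rule lin[OF scale(1)])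
      show ?thesis
        by (simp add: scale(2) E.diff E.scale free_eval_single[OF sM] L.scale)
    qed
  qed
  have span: "free_eval sM \<phi> r = 0" if "r \<in> F.span (tensor_relations s n)" for r
    using that E.eq_0_on_span[of "tensor_relations s n" r] rel by blast
  define q where "q = (SOME q. q \<in> tensor_class s n p)"
  have "p \<in> tensor_class s n p"
    using p by (simp add: tensor_class_def F.span_zero)
  then have "q \<in> tensor_class s n p"
    unfolding q_def by (rule someI)
  then have "free_eval sM \<phi> (q - p) = 0"
    by (intro span) (simp add: tensor_class_def)
  then have "free_eval sM \<phi> q = free_eval sM \<phi> p"
    by (simp add: E.diff)
  then show ?thesis
    by (simp add: tensor_lift_def free_eval_def q_def Let_def)
qed

section \<open>Algebras, coalgebras and Hopf algebras\<close>

text \<open>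
  The class \<^class>\<open>ring_1\<close> excludes the zero algebra. For a bialgebra this is no
  restriction, since \<open>\<epsilon>(1) = 1 \<noteq> 0\<close> in the field.
\<close>

locale k_algebra = vector_space scale
  for scale :: "'k::field \<Rightarrow> 'a::ring_1 \<Rightarrow> 'a" +
  assumes scale_mult_left: "scale c a * b = scale c (a * b)"
    and scale_mult_right: "a * scale c b = scale c (a * b)"

locale coalgebra = vector_space scale
  for scale :: "'k::field \<Rightarrow> 'd::ab_group_add \<Rightarrow> 'd"
    and \<Delta> :: "'d \<Rightarrow> ('k, 'd) tensor"
    and \<epsilon> :: "'d \<Rightarrow> 'k" +
  assumes comult_closed: "\<Delta> x \<in> tensor_power scale 2"
    and comult_add: "\<Delta> (x + y) = tensor_add scale 2 (\<Delta> x) (\<Delta> y)"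
    and comult_scale: "\<Delta> (scale c x) = tensor_scale scale 2 c (\<Delta> x)"
    and counit_linear: "Vector_Spaces.linear scale (*) \<epsilon>"
    and coassoc:
      "tensor_lift_tensor scale 3
         (\<lambda>xs. tensor_lift_tensor scale 3 (\<lambda>ys. pure scale [ys ! 0, ys ! 1, xs ! 1]) (\<Delta> (xs ! 0)))
         (\<Delta> x) =
       tensor_lift_tensor scale 3
         (\<lambda>xs. tensor_lift_tensor scale 3 (\<lambda>ys. pure scale [xs ! 0, ys ! 0, ys ! 1]) (\<Delta> (xs ! 1)))
         (\<Delta> x)"
    and counit_left: "tensor_lift scale (\<lambda>xs. scale (\<epsilon> (xs ! 0)) (xs ! 1)) (\<Delta> x) = x"
    and counit_right: "tensor_lift scale (\<lambda>xs. scale (\<epsilon> (xs ! 1)) (xs ! 0)) (\<Delta> x) = x"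

text \<open>
  \<open>iterated_comult scale \<Delta> n x\<close> is
  \<open>x\<^sub>(\<^sub>1\<^sub>) \<otimes> \<dots> \<otimes> x\<^sub>(\<^sub>n\<^sub>+\<^sub>1\<^sub>)\<close>.
\<close>

primrec iterated_comult ::
  "('k::field \<Rightarrow> 'd::ab_group_add \<Rightarrow> 'd) \<Rightarrow> ('d \<Rightarrow> ('k, 'd) tensor)
    \<Rightarrow> nat \<Rightarrow> 'd \<Rightarrow> ('k, 'd) tensor" where
  "iterated_comult scale \<Delta> 0 = (\<lambda>x. pure scale [x])"
| "iterated_comult scale \<Delta> (Suc n) =
     (\<lambda>x. tensor_lift_tensor scale (n + 2)
        (\<lambda>xs. tensor_lift_tensor scale (n + 2) (\<lambda>ys. pure scale (xs ! 0 # ys))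
                (iterated_comult scale \<Delta> n (xs ! 1)))
        (\<Delta> x))"

locale hopf_algebra = k_algebra scale + coalgebra scale \<Delta> \<epsilon>
  for scale :: "'k::field \<Rightarrow> 'h::ring_1 \<Rightarrow> 'h"
    and \<Delta> :: "'h \<Rightarrow> ('k, 'h) tensor"
    and \<epsilon> :: "'h \<Rightarrow> 'k" +
  fixes S :: "'h \<Rightarrow> 'h"
  assumes comult_one: "\<Delta> 1 = pure scale [1, 1]"
    and comult_mult:
      "\<Delta> (g * h) =
         tensor_lift_tensor scale 2
           (\<lambda>gs. tensor_lift_tensor scale 2
                   (\<lambda>hs. pure scale [gs ! 0 * hs ! 0, gs ! 1 * hs ! 1]) (\<Delta> h))
           (\<Delta> g)"
    and counit_one: "\<epsilon> 1 = 1"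
    and counit_mult: "\<epsilon> (g * h) = \<epsilon> g * \<epsilon> h"
    and antipode_linear: "Vector_Spaces.linear scale scale S"
    and antipode_left: "tensor_lift scale (\<lambda>hs. S (hs ! 0) * hs ! 1) (\<Delta> h) = scale (\<epsilon> h) 1"
    and antipode_right: "tensor_lift scale (\<lambda>hs. hs ! 0 * S (hs ! 1)) (\<Delta> h) = scale (\<epsilon> h) 1"

section \<open>Modules, module coalgebras and contramodules\<close>

locale left_module = A: k_algebra scaleA + V: vector_space scale
  for scaleA :: "'k::field \<Rightarrow> 'a::ring_1 \<Rightarrow> 'a"
    and scale :: "'k \<Rightarrow> 'v::ab_group_add \<Rightarrow> 'v" +
  fixes act :: "'a \<Rightarrow> 'v \<Rightarrow> 'v"
  assumes act_linear_right: "Vector_Spaces.linear scale scale (act a)"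
    and act_linear_left: "Vector_Spaces.linear scaleA scale (\<lambda>a. act a v)"
    and act_one: "act 1 v = v"
    and act_mult: "act (a * b) v = act a (act b v)"

text \<open>The diagonal action of \<open>H\<close> on \<open>C\<^sup>\<otimes>\<^sup>n\<^sup>+\<^sup>1\<close>.\<close>

definition diagonal_act ::
  "('k::field \<Rightarrow> 'h::ring_1 \<Rightarrow> 'h) \<Rightarrow> ('h \<Rightarrow> ('k, 'h) tensor)
    \<Rightarrow> ('k \<Rightarrow> 'c::ab_group_add \<Rightarrow> 'c) \<Rightarrow> ('h \<Rightarrow> 'c \<Rightarrow> 'c)
    \<Rightarrow> nat \<Rightarrow> 'h \<Rightarrow> ('k, 'c) tensor \<Rightarrow> ('k, 'c) tensor" where
  "diagonal_act sH \<Delta>H sC actC n h =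
     tensor_lift_tensor sC (n + 1)
       (\<lambda>cs. tensor_lift_tensor sC (n + 1) (\<lambda>hs. pure sC (map2 actC hs cs))
               (iterated_comult sH \<Delta>H n h))"

locale module_coalgebra =
  H: hopf_algebra sH \<Delta>H \<epsilon>H S + C: coalgebra sC \<Delta>C \<epsilon>C + CM: left_module sH sC actC
  for sH :: "'k::field \<Rightarrow> 'h::ring_1 \<Rightarrow> 'h" and \<Delta>H \<epsilon>H S
    and sC :: "'k \<Rightarrow> 'c::ab_group_add \<Rightarrow> 'c" and \<Delta>C \<epsilon>C
    and actC :: "'h \<Rightarrow> 'c \<Rightarrow> 'c" +
  assumes comult_act:
      "\<Delta>C (actC h c) =
         tensor_lift_tensor sC 2
           (\<lambda>hs. tensor_lift_tensor sC 2
                   (\<lambda>cs. pure sC [actC (hs ! 0) (cs ! 0), actC (hs ! 1) (cs ! 1)]) (\<Delta>C c))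
           (\<Delta>H h)"
    and counit_act: "\<epsilon>C (actC h c) = \<epsilon>H h * \<epsilon>C c"

text \<open>
  The type of \<open>\<alpha>\<close> is larger than \<open>Hom(D, M) \<rightarrow> M\<close>: its values on
  nonlinear functions are arbitrary and never used.
\<close>

locale right_contramodule =
  D: coalgebra sD \<Delta> \<epsilon> + M: vector_space sM
  for sD :: "'k::field \<Rightarrow> 'd::ab_group_add \<Rightarrow> 'd" and \<Delta> \<epsilon>
    and sM :: "'k \<Rightarrow> 'm::ab_group_add \<Rightarrow> 'm" +
  fixes \<alpha> :: "('d \<Rightarrow> 'm) \<Rightarrow> 'm"
  assumes contra_add:
      "\<lbrakk>Vector_Spaces.linear sD sM f; Vector_Spaces.linear sD sM g\<rbrakk>
        \<Longrightarrow> \<alpha> (\<lambda>x. f x + g x) = \<alpha> f + \<alpha> g"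
    and contra_scale:
      "Vector_Spaces.linear sD sM f \<Longrightarrow> \<alpha> (\<lambda>x. sM c (f x)) = sM c (\<alpha> f)"
    and contra_assoc:
      "F \<in> tensor_hom sD 2 sM
        \<Longrightarrow> \<alpha> (\<lambda>x. \<alpha> (\<lambda>y. F (pure sD [x, y]))) = \<alpha> (\<lambda>x. F (\<Delta> x))"
    and contra_unit: "\<alpha> (\<lambda>x. sM (\<epsilon> x) m) = m"

locale ayd_contramodule =
  H: hopf_algebra sH \<Delta>H \<epsilon>H S + MM: left_module sH sM actM + MC: right_contramodule sH \<Delta>H \<epsilon>H sM \<alpha>
  for sH :: "'k::field \<Rightarrow> 'h::ring_1 \<Rightarrow> 'h" and \<Delta>H \<epsilon>H S
    and sM :: "'k \<Rightarrow> 'm::ab_group_add \<Rightarrow> 'm"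
    and actM :: "'h \<Rightarrow> 'm \<Rightarrow> 'm"
    and \<alpha> :: "('h \<Rightarrow> 'm) \<Rightarrow> 'm" +
  assumes ayd:
    "Vector_Spaces.linear sH sM f \<Longrightarrow>
       actM h (\<alpha> f) =
         \<alpha> (\<lambda>h'. tensor_lift sM (\<lambda>hs. actM (hs ! 1) (f (S (hs ! 2) * h' * hs ! 0)))
                   (iterated_comult sH \<Delta>H 2 h))"

locale stable_ayd_contramodule = ayd_contramodule sH \<Delta>H \<epsilon>H S sM actM \<alpha>
  for sH :: "'k::field \<Rightarrow> 'h::ring_1 \<Rightarrow> 'h" and \<Delta>H \<epsilon>H S
    and sM :: "'k \<Rightarrow> 'm::ab_group_add \<Rightarrow> 'm"
    and actM :: "'h \<Rightarrow> 'm \<Rightarrow> 'm"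
    and \<alpha> :: "('h \<Rightarrow> 'm) \<Rightarrow> 'm" +
  assumes stable: "\<alpha> (\<lambda>h. actM h m) = m"

section \<open>Cyclic modules\<close>

text \<open>
  The spaces \<open>X n\<close> are subspaces of one ambient vector space. The face
  \<open>d n i\<close>, degeneracy \<open>s n j\<close> and cyclic operator \<open>t n\<close> are those
  with source \<open>X n\<close>; in degree \<open>0\<close> there are no faces.
\<close>

locale cyclic_module = vector_space scale
  for scale :: "'k::field \<Rightarrow> 'x::ab_group_add \<Rightarrow> 'x"
    and X :: "nat \<Rightarrow> 'x set"
    and d s :: "nat \<Rightarrow> nat \<Rightarrow> 'x \<Rightarrow> 'x"
    and t :: "nat \<Rightarrow> 'x \<Rightarrow> 'x" +
  assumes subspace_X: "module.subspace scale (X n)"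
    and face_closed: "\<lbrakk>1 \<le> n; i \<le> n; x \<in> X n\<rbrakk> \<Longrightarrow> d n i x \<in> X (n - 1)"
    and face_add: "\<lbrakk>1 \<le> n; i \<le> n; x \<in> X n; y \<in> X n\<rbrakk> \<Longrightarrow> d n i (x + y) = d n i x + d n i y"
    and face_scale: "\<lbrakk>1 \<le> n; i \<le> n; x \<in> X n\<rbrakk> \<Longrightarrow> d n i (scale c x) = scale c (d n i x)"
    and degen_closed: "\<lbrakk>j \<le> n; x \<in> X n\<rbrakk> \<Longrightarrow> s n j x \<in> X (n + 1)"
    and degen_add: "\<lbrakk>j \<le> n; x \<in> X n; y \<in> X n\<rbrakk> \<Longrightarrow> s n j (x + y) = s n j x + s n j y"
    and degen_scale: "\<lbrakk>j \<le> n; x \<in> X n\<rbrakk> \<Longrightarrow> s n j (scale c x) = scale c (s n j x)"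
    and cyclic_closed: "x \<in> X n \<Longrightarrow> t n x \<in> X n"
    and cyclic_add: "\<lbrakk>x \<in> X n; y \<in> X n\<rbrakk> \<Longrightarrow> t n (x + y) = t n x + t n y"
    and cyclic_scale: "x \<in> X n \<Longrightarrow> t n (scale c x) = scale c (t n x)"
    and face_face:
      "\<lbrakk>2 \<le> n; i < j; j \<le> n; x \<in> X n\<rbrakk> \<Longrightarrow> d (n - 1) i (d n j x) = d (n - 1) (j - 1) (d n i x)"
    and degen_degen:
      "\<lbrakk>i \<le> j; j \<le> n; x \<in> X n\<rbrakk> \<Longrightarrow> s (n + 1) i (s n j x) = s (n + 1) (j + 1) (s n i x)"
    and face_degen_less:
      "\<lbrakk>i < j; j \<le> n; x \<in> X n\<rbrakk> \<Longrightarrow> d (n + 1) i (s n j x) = s (n - 1) (j - 1) (d n i x)"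
    and face_degen_same: "\<lbrakk>j \<le> n; x \<in> X n\<rbrakk> \<Longrightarrow> d (n + 1) j (s n j x) = x"
    and face_degen_succ: "\<lbrakk>j \<le> n; x \<in> X n\<rbrakk> \<Longrightarrow> d (n + 1) (j + 1) (s n j x) = x"
    and face_degen_greater:
      "\<lbrakk>j + 1 < i; i \<le> n + 1; x \<in> X n\<rbrakk> \<Longrightarrow> d (n + 1) i (s n j x) = s (n - 1) j (d n (i - 1) x)"
    and face_cyclic:
      "\<lbrakk>1 \<le> i; i \<le> n; x \<in> X n\<rbrakk> \<Longrightarrow> d n i (t n x) = t (n - 1) (d n (i - 1) x)"
    and face_zero_cyclic: "\<lbrakk>1 \<le> n; x \<in> X n\<rbrakk> \<Longrightarrow> d n 0 (t n x) = d n n x"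
    and degen_cyclic:
      "\<lbrakk>1 \<le> i; i \<le> n; x \<in> X n\<rbrakk> \<Longrightarrow> s n i (t n x) = t (n + 1) (s n (i - 1) x)"
    and degen_zero_cyclic: "x \<in> X n \<Longrightarrow> s n 0 (t n x) = (t (n + 1) ^^ 2) (s n n x)"
    and cyclic_power: "x \<in> X n \<Longrightarrow> (t n ^^ (n + 1)) x = x"

section \<open>The cochains with coefficients in a contramodule\<close>

definition pointwise_scale ::
  "('k \<Rightarrow> 'm \<Rightarrow> 'm) \<Rightarrow> 'k \<Rightarrow> ('u \<Rightarrow> 'm) \<Rightarrow> ('u \<Rightarrow> 'm)" where
  "pointwise_scale sM c f = (\<lambda>u. sM c (f u))"

definition cochains ::
  "('k::field \<Rightarrow> 'h::ring_1 \<Rightarrow> 'h) \<Rightarrow> ('h \<Rightarrow> ('k, 'h) tensor)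
    \<Rightarrow> ('k \<Rightarrow> 'c::ab_group_add \<Rightarrow> 'c) \<Rightarrow> ('h \<Rightarrow> 'c \<Rightarrow> 'c)
    \<Rightarrow> ('k \<Rightarrow> 'm::ab_group_add \<Rightarrow> 'm) \<Rightarrow> ('h \<Rightarrow> 'm \<Rightarrow> 'm)
    \<Rightarrow> nat \<Rightarrow> (('k, 'c) tensor \<Rightarrow> 'm) set" where
  "cochains sH \<Delta>H sC actC sM actM n =
     {f \<in> tensor_hom sC (n + 1) sM.
        \<forall>h. \<forall>u \<in> tensor_power sC (n + 1). f (diagonal_act sH \<Delta>H sC actC n h u) = actM h (f u)}"

definition face_formula ::
  "('k::field \<Rightarrow> 'c::ab_group_add \<Rightarrow> 'c) \<Rightarrow> ('c \<Rightarrow> ('k, 'c) tensor) \<Rightarrow> ('h \<Rightarrow> 'c \<Rightarrow> 'c)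
    \<Rightarrow> ('k \<Rightarrow> 'm::ab_group_add \<Rightarrow> 'm) \<Rightarrow> (('h \<Rightarrow> 'm) \<Rightarrow> 'm)
    \<Rightarrow> nat \<Rightarrow> nat \<Rightarrow> (('k, 'c) tensor \<Rightarrow> 'm) \<Rightarrow> 'c list \<Rightarrow> 'm" where
  "face_formula sC \<Delta>C actC sM \<alpha> n i f cs =
     (if i < n
      then tensor_lift sM (\<lambda>xs. f (pure sC (take i cs @ [xs ! 0, xs ! 1] @ drop (i + 1) cs)))
             (\<Delta>C (cs ! i))
      else \<alpha> (\<lambda>h. tensor_lift sM (\<lambda>xs. f (pure sC ([xs ! 1] @ drop 1 cs @ [actC h (xs ! 0)])))
                    (\<Delta>C (cs ! 0))))"

definition degen_formula ::
  "('k::field \<Rightarrow> 'c::ab_group_add \<Rightarrow> 'c) \<Rightarrow> ('c \<Rightarrow> 'k) \<Rightarrow> ('k \<Rightarrow> 'm::ab_group_add \<Rightarrow> 'm)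
    \<Rightarrow> nat \<Rightarrow> (('k, 'c) tensor \<Rightarrow> 'm) \<Rightarrow> 'c list \<Rightarrow> 'm" where
  "degen_formula sC \<epsilon>C sM j f cs =
     sM (\<epsilon>C (cs ! (j + 1))) (f (pure sC (take (j + 1) cs @ drop (j + 2) cs)))"

definition cyclic_formula ::
  "('k::field \<Rightarrow> 'c::ab_group_add \<Rightarrow> 'c) \<Rightarrow> ('h \<Rightarrow> 'c \<Rightarrow> 'c) \<Rightarrow> (('h \<Rightarrow> 'm::ab_group_add) \<Rightarrow> 'm)
    \<Rightarrow> (('k, 'c) tensor \<Rightarrow> 'm) \<Rightarrow> 'c list \<Rightarrow> 'm" where
  "cyclic_formula sC actC \<alpha> f cs = \<alpha> (\<lambda>h. f (pure sC (drop 1 cs @ [actC h (cs ! 0)])))"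

definition face where
  "face sC \<Delta>C actC sM \<alpha> n i f = tensor_fun sC n sM (face_formula sC \<Delta>C actC sM \<alpha> n i f)"

definition degen where
  "degen sC \<epsilon>C sM n j f = tensor_fun sC (n + 2) sM (degen_formula sC \<epsilon>C sM j f)"

definition cyclic_op where
  "cyclic_op sC actC sM \<alpha> n f = tensor_fun sC (n + 1) sM (cyclic_formula sC actC \<alpha> f)"

end

theory Submission
  imports Defs
begin

text \<open>A linear map on a tensor power is determined by its values on pure tensors, and these values are an
arbitrary multilinear function of words (\<open>tensor_fun_hom\<close>, \<open>tensor_hom_eqI\<close>). So all operators can be
evaluated, and all identities checked, on words. A Sweedler expression becomes a finite linear
combination, taken over a fixed representative of the comultiplied element. Such combinations commute
with each other, with linear maps and, for summands linear in the free argument, with the contramodule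
structure \<open>\<alpha>\<close>; the coalgebra axioms apply to them as soon as the summand is multilinear.

The content of the theorem is in the cyclic operator. Contraassociativity turns nested applications
of \<open>\<alpha>\<close> into one Sweedler sum, which gives for all \<open>j \<le> n + 1\<close> (\<open>cyclic_iterate_pure\<close>)
that \<open>t\<^sup>j f\<close> maps \<open>(c\<^sub>0, \<dots>, c\<^sub>n)\<close> to \<open>\<alpha>(h \<mapsto> f(c\<^sub>j, \<dots>, c\<^sub>n, h\<^sub>(\<^sub>1\<^sub>) c\<^sub>0, \<dots>, h\<^sub>(\<^sub>j\<^sub>) c\<^sub>j\<^sub>-\<^sub>1))\<close>.
For \<open>j = n + 1\<close> the integrand is \<open>f\<close> evaluated on the diagonal action of \<open>h\<close>, hence
\<open>h \<cdot> f(c\<^sub>0, \<dots>, c\<^sub>n)\<close>, and stability of \<open>M\<close> gives \<open>t\<^sub>n\<^sup>n\<^sup>+\<^sup>1 = id\<close>. The case \<open>j = 2\<close>,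
combined with the compatibility of \<open>\<Delta>\<^sub>C\<close> and \<open>\<epsilon>\<^sub>C\<close> with the action, gives \<open>d\<^sub>n t\<^sub>n = t\<^sub>n\<^sub>-\<^sub>1 d\<^sub>n\<^sub>-\<^sub>1\<close> and
\<open>s\<^sub>0 t\<^sub>n = t\<^sub>n\<^sub>+\<^sub>1\<^sup>2 s\<^sub>n\<close>.

That \<open>t\<^sub>n f\<close> is again \<open>H\<close>-linear (\<open>cyclic_closed\<close>) is where the anti-Yetter-Drinfeld condition enters: it
rewrites \<open>h \<cdot> \<alpha>(f(c\<^sub>1, \<dots>, c\<^sub>n, (-) c\<^sub>0))\<close> as
\<open>\<alpha>(h' \<mapsto> h\<^sub>(\<^sub>2\<^sub>) \<cdot> f(c\<^sub>1, \<dots>, c\<^sub>n, S(h\<^sub>(\<^sub>3\<^sub>)) h' h\<^sub>(\<^sub>1\<^sub>) c\<^sub>0))\<close>,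
the \<open>H\<close>-linearity of \<open>f\<close> distributes \<open>h\<^sub>(\<^sub>2\<^sub>)\<close> over the arguments, and its last part cancels against
\<open>S(h\<^sub>(\<^sub>3\<^sub>))\<close>, which leaves exactly \<open>t\<^sub>n(f)\<close> on the diagonal action of \<open>h\<close>.

For the other identities the key is \<open>d\<^sub>n = d\<^sub>0 t\<^sub>n\<close> (\<open>last_face_eq\<close>). Those without a last face follow from
coassociativity and the counit of \<open>C\<close>, or say that \<open>t\<close> shifts positions; those with a last face reduce
to them by moving \<open>t\<close> across faces and degeneracies. The one exception is \<open>d\<^sub>n\<^sub>+\<^sub>1 s\<^sub>n = id\<close>, where the
deleted letter carries the free argument of \<open>\<alpha>\<close> and the unit axiom of the contramodule is used.\<close>

section \<open>Multilinear functions of words and linear maps on tensor powers\<close>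

lemma linearI:
  assumes "vector_space s1" "vector_space s2"
    and "\<And>x y. f (x + y) = f x + f y" "\<And>c x. f (s1 c x) = s2 c (f x)"
  shows "Vector_Spaces.linear s1 s2 f"
proof -
  interpret V: vector_space s1 by fact
  interpret W: vector_space s2 by fact
  show ?thesis by unfold_locales (simp_all add: assms(3,4))
qed

lemma
  assumes "Vector_Spaces.linear s1 s2 f"
  shows linear_source_vector_space: "vector_space s1" and linear_target_vector_space: "vector_space s2"
    and linear_plus: "f (x + y) = f x + f y" and linear_scale: "f (s1 c x) = s2 c (f x)"
    and linear_sum: "f (sum g A) = (\<Sum>a\<in>A. f (g a))"
proof -
  interpret L: Vector_Spaces.linear s1 s2 f by fact
  show "vector_space s1" "vector_space s2" "f (x + y) = f x + f y" "f (s1 c x) = s2 c (f x)"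
    "f (sum g A) = (\<Sum>a\<in>A. f (g a))"
    by (simp_all add: L.add L.scale L.sum L.vs1.vector_space_axioms L.vs2.vector_space_axioms)
qed

lemma linear_comp:
  assumes "Vector_Spaces.linear s2 s3 g" "Vector_Spaces.linear s1 s2 f"
  shows "Vector_Spaces.linear s1 s3 (\<lambda>x. g (f x))"
  by (rule linearI) (simp_all add: linear_source_vector_space[OF assms(2)] linear_target_vector_space[OF assms(1)]
    linear_plus[OF assms(1)] linear_plus[OF assms(2)] linear_scale[OF assms(1)] linear_scale[OF assms(2)])

lemma linear_scaled:
  assumes "Vector_Spaces.linear s1 s2 f"
  shows "Vector_Spaces.linear s1 s2 (\<lambda>x. s2 c (f x))"
proof -
  interpret W: vector_space s2 by (rule linear_target_vector_space[OF assms])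
  show ?thesis
    by (rule linearI) (simp_all add: linear_source_vector_space[OF assms] W.vector_space_axioms
        linear_plus[OF assms] linear_scale[OF assms] W.scale_right_distrib mult.commute)
qed

lemma linear_scalar_times:
  assumes "Vector_Spaces.linear s1 (*) e" "vector_space s2"
  shows "Vector_Spaces.linear s1 s2 (\<lambda>x. s2 (e x) m)"
proof -
  interpret W: vector_space s2 by fact
  show ?thesis
    by (rule linearI) (simp_all add: linear_source_vector_space[OF assms(1)] W.vector_space_axioms
        linear_plus[OF assms(1)] linear_scale[OF assms(1)] W.scale_left_distrib)
qed

lemma linear_identity: "vector_space s \<Longrightarrow> Vector_Spaces.linear s s (\<lambda>x. x)"
  by (rule linearI) simp_all

lemma linear_combination:
  assumes "finite A" "vector_space s1" "vector_space s2"
    and "\<And>x. x \<in> A \<Longrightarrow> Vector_Spaces.linear s1 s2 (\<phi> x)"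
  shows "Vector_Spaces.linear s1 s2 (\<lambda>z. \<Sum>x\<in>A. s2 (c x) (\<phi> x z))"
proof -
  interpret W: vector_space s2 by fact
  show ?thesis
  proof (rule linearI[OF assms(2,3)])
    fix x y
    have "(\<Sum>a\<in>A. s2 (c a) (\<phi> a (x + y))) = (\<Sum>a\<in>A. s2 (c a) (\<phi> a x) + s2 (c a) (\<phi> a y))"
      by (rule sum.cong) (simp_all add: linear_plus[OF assms(4)] W.scale_right_distrib)
    then show "(\<Sum>a\<in>A. s2 (c a) (\<phi> a (x + y))) = (\<Sum>a\<in>A. s2 (c a) (\<phi> a x)) + (\<Sum>a\<in>A. s2 (c a) (\<phi> a y))"
      by (simp add: sum.distrib)
  next
    fix k x
    show "(\<Sum>a\<in>A. s2 (c a) (\<phi> a (s1 k x))) = s2 k (\<Sum>a\<in>A. s2 (c a) (\<phi> a x))"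
      unfolding W.scale_sum_right
      by (rule sum.cong) (simp_all add: linear_scale[OF assms(4)] mult.commute)
  qed
qed

definition multilinear ::
  "('k::field \<Rightarrow> 'v::ab_group_add \<Rightarrow> 'v) \<Rightarrow> ('k \<Rightarrow> 'm::ab_group_add \<Rightarrow> 'm) \<Rightarrow> nat \<Rightarrow> ('v list \<Rightarrow> 'm) \<Rightarrow> bool" where
  "multilinear s sM n \<phi> \<longleftrightarrow>
     (\<forall>xs ys. length xs + length ys + 1 = n \<longrightarrow> Vector_Spaces.linear s sM (\<lambda>a. \<phi> (xs @ a # ys)))"

lemma multilinearD:
  assumes "multilinear s sM n \<phi>" "length xs + length ys + 1 = n"
  shows "Vector_Spaces.linear s sM (\<lambda>a. \<phi> (xs @ a # ys))"
  using assms by (simp add: multilinear_def)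

lemma linear_multilinear_comp:
  assumes "multilinear s sM n \<phi>" "Vector_Spaces.linear s1 s L" "length xs + length ys + 1 = n"
  shows "Vector_Spaces.linear s1 sM (\<lambda>z. \<phi> (xs @ L z # ys))"
  by (rule linear_comp[OF multilinearD[OF assms(1,3)] assms(2)])

lemma multilinear_cong:
  assumes "\<And>xs. length xs = n \<Longrightarrow> \<phi> xs = \<psi> xs" "multilinear s sM n \<psi>"
  shows "multilinear s sM n \<phi>"
  using assms by (simp add: multilinear_def)

text \<open>Splitting off the argument at position \<open>i\<close> turns the verification of multilinearity
  into linearity in one argument and multilinearity in the rest.\<close>

lemma multilinear_insertI:
  fixes s :: "'k::field \<Rightarrow> 'v::ab_group_add \<Rightarrow> 'v"
  assumes "i < n"
    and at: "\<And>us vs. length us = i \<Longrightarrow> length us + length vs + 1 = n \<Longrightarrow>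
          Vector_Spaces.linear s sM (\<lambda>a. \<phi> (us @ a # vs))"
    and off: "\<And>c. multilinear s sM (n - 1) (\<lambda>xs. \<phi> (take i xs @ c # drop i xs))"
  shows "multilinear s sM n \<phi>"
  unfolding multilinear_def
proof (intro allI impI)
  fix xs ys :: "'v list"
  assume len: "length xs + length ys + 1 = n"
  consider "length xs = i" | "i < length xs" | "length xs < i" by linarith
  then show "Vector_Spaces.linear s sM (\<lambda>a. \<phi> (xs @ a # ys))"
  proof cases
    case 1
    then show ?thesis using at len by blast
  next
    case 2
    then obtain us c vs where xs: "xs = us @ c # vs" "length us = i"
      using id_take_nth_drop[of i xs] by (metis length_take min.absorb4)
    have "Vector_Spaces.linear s sM
        (\<lambda>a. \<phi> (take i ((us @ vs) @ a # ys) @ c # drop i ((us @ vs) @ a # ys)))"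
      by (rule multilinearD[OF off]) (use xs len in simp)
    then show ?thesis using xs by simp
  next
    case 3
    \<comment> \<open>Position \<open>i\<close> falls into \<open>ys\<close>, at index \<open>j\<close> once \<open>xs\<close> and \<open>a\<close> are skipped.\<close>
    define j where "j = i - Suc (length xs)"
    have j: "j < length ys" "i = length xs + Suc j" using 3 len \<open>i < n\<close> by (auto simp: j_def)
    obtain us c vs where ys: "ys = us @ c # vs" "length us = j"
      using id_take_nth_drop[of j ys] j(1) by (metis length_take min.absorb4)
    have "Vector_Spaces.linear s sM
        (\<lambda>a. \<phi> (take i (xs @ a # us @ vs) @ c # drop i (xs @ a # us @ vs)))"
      by (rule multilinearD[OF off]) (use ys len in simp)
    then show ?thesis using ys j by simp
  qed
qed

text \<open>The same insertion read backwards: freezing the argument at one position keeps multilinearity.\<close>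

lemma multilinear_fix:
  fixes s :: "'k::field \<Rightarrow> 'v::ab_group_add \<Rightarrow> 'v"
  assumes "multilinear s sM (Suc n) \<phi>" "i \<le> n"
  shows "multilinear s sM n (\<lambda>xs. \<phi> (take i xs @ c # drop i xs))"
  unfolding multilinear_def
proof (intro allI impI)
  fix xs ys :: "'v list"
  assume len: "length xs + length ys + 1 = n"
  show "Vector_Spaces.linear s sM (\<lambda>a. \<phi> (take i (xs @ a # ys) @ c # drop i (xs @ a # ys)))"
  proof (cases "i \<le> length xs")
    case True
    then show ?thesis
      using multilinearD[OF assms(1), of "take i xs @ c # drop i xs" ys] len by simp
  next
    case False
    then obtain j where "i = length xs + Suc j" by (metis add_Suc_right less_iff_Suc_add not_le)
    then show ?thesis
      using multilinearD[OF assms(1), of xs "take j ys @ c # drop j ys"] len assms(2) by simp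
  qed
qed

lemma multilinear_append:
  fixes s :: "'k::field \<Rightarrow> 'v::ab_group_add \<Rightarrow> 'v"
  assumes "multilinear s sM (length us + n + length vs) \<phi>"
  shows "multilinear s sM n (\<lambda>xs. \<phi> (us @ xs @ vs))"
  unfolding multilinear_def
proof (intro allI impI)
  fix xs ys :: "'v list"
  assume len: "length xs + length ys + 1 = n"
  show "Vector_Spaces.linear s sM (\<lambda>a. \<phi> (us @ (xs @ a # ys) @ vs))"
    using multilinearD[OF assms, of "us @ xs" "ys @ vs"] len by simp
qed

lemma multilinear_Cons:
  assumes "multilinear s sM (Suc n) \<phi>"
  shows "multilinear s sM n (\<lambda>xs. \<phi> (c # xs))"
  using multilinear_append[of s sM "[c]" n "[]" \<phi>] assms by simp

lemma multilinear_scaled: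
  assumes "multilinear s sM n \<phi>"
  shows "multilinear s sM n (\<lambda>xs. sM c (\<phi> xs))"
  unfolding multilinear_def using linear_scaled[OF multilinearD[OF assms]] by blast

lemma multilinear_map2:
  fixes s1 :: "'k::field \<Rightarrow> 'h::ab_group_add \<Rightarrow> 'h"
  assumes "multilinear s sM n \<phi>" "\<And>c. Vector_Spaces.linear s1 s (\<lambda>h. a h c)" "length cs = n"
  shows "multilinear s1 sM n (\<lambda>hs. \<phi> (map2 a hs cs))"
  unfolding multilinear_def
proof (intro allI impI)
  fix xs ys :: "'h list"
  assume len: "length xs + length ys + 1 = n"
  define us c vs where "us = take (length xs) cs" "c = cs ! length xs" "vs = drop (Suc (length xs)) cs"
  have cs: "cs = us @ c # vs" "length us = length xs"
    using len assms(3) by (simp_all add: us_c_vs_def id_take_nth_drop[symmetric])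
  show "Vector_Spaces.linear s1 sM (\<lambda>h. \<phi> (map2 a (xs @ h # ys) cs))"
    using linear_multilinear_comp[OF assms(1,2), of "map2 a xs us" "map2 a ys vs" c] len assms(3) cs
    by simp
qed

lemma map2_swap: "map2 f xs ys = map2 (\<lambda>y x. f x y) ys xs"
  by (induction xs ys rule: list_induct2') auto

lemma multilinear_map2_right:
  assumes "multilinear s sM n \<phi>" "\<And>h. Vector_Spaces.linear s1 s (a h)" "length hs = n"
  shows "multilinear s1 sM n (\<lambda>cs. \<phi> (map2 a hs cs))"
  using multilinear_map2[OF assms(1), of s1 "\<lambda>c h. a h c" hs] assms(2,3) by (simp add: map2_swap[of a hs])

section \<open>Tensor powers\<close>


lemma words_add: "p \<in> words n \<Longrightarrow> q \<in> words n \<Longrightarrow> p + q \<in> words n"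
  using Poly_Mapping.keys_add[of p q] by (auto simp: words_def)

lemma words_scale: "p \<in> words n \<Longrightarrow> free_scale c p \<in> words n"
  by (auto simp: words_def in_keys_iff)

lemma words_zero: "0 \<in> words n" by (simp add: words_def)

lemma words_sum: "(\<And>a. a \<in> A \<Longrightarrow> g a \<in> words n) \<Longrightarrow> sum g A \<in> words n"
  by (induction A rule: infinite_finite_induct) (simp_all add: words_zero words_add)

lemma words_single: "length xs = n \<Longrightarrow> Poly_Mapping.single xs c \<in> words n"
  by (simp add: words_def)

lemma tensor_class_self: "p \<in> words n \<Longrightarrow> p \<in> tensor_class s n p"
proof -
  interpret F: vector_space free_scale by (rule vector_space_free_scale)
  show "p \<in> words n \<Longrightarrow> p \<in> tensor_class s n p"
    by (simp add: tensor_class_def F.span_zero)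
qed

text \<open>Classes are cosets of the span of the relations, so any two representatives can be exchanged. This
makes the unions in \<^const>\<open>tensor_add\<close> and \<^const>\<open>tensor_scale\<close> collapse to a single class.\<close>

lemma tensor_class_eqI:
  assumes "q - p \<in> module.span free_scale (tensor_relations s n)"
  shows "tensor_class s n q = tensor_class s n p"
proof -
  interpret F: vector_space free_scale by (rule vector_space_free_scale)
  have "r - q \<in> F.span (tensor_relations s n) \<longleftrightarrow> r - p \<in> F.span (tensor_relations s n)" for r
    using F.span_add[OF _ assms, of "r - q"] F.span_diff[OF _ assms, of "r - p"] by (auto simp: algebra_simps)
  then show ?thesis by (simp add: tensor_class_def)
qed

lemma tensor_class_eq: "q \<in> tensor_class s n p \<Longrightarrow> tensor_class s n q = tensor_class s n p"
  by (rule tensor_class_eqI) (simp add: tensor_class_def)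

lemma tensor_class_closed: "p \<in> words n \<Longrightarrow> tensor_class s n p \<in> tensor_power s n"
  by (simp add: tensor_power_def)

lemma tensor_powerE:
  assumes "u \<in> tensor_power s n"
  obtains p where "p \<in> words n" "u = tensor_class s n p"
  using assms by (auto simp: tensor_power_def)

lemma tensor_rep:
  assumes "u \<in> tensor_power s n"
  shows "(SOME p. p \<in> u) \<in> words n" "tensor_class s n (SOME p. p \<in> u) = u"
proof -
  obtain p where p: "p \<in> words n" "u = tensor_class s n p" by (rule tensor_powerE[OF assms])
  have "(SOME p. p \<in> u) \<in> u" using tensor_class_self[OF p(1), of s] p(2) by (auto intro: someI)
  then show "(SOME p. p \<in> u) \<in> words n" "tensor_class s n (SOME p. p \<in> u) = u"
    using tensor_class_eq[of _ s n p] p(2) by (auto simp: tensor_class_def)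
qed

lemma tensor_add_class:
  assumes "p \<in> words n" "q \<in> words n"
  shows "tensor_add s n (tensor_class s n p) (tensor_class s n q) = tensor_class s n (p + q)"
proof -
  interpret F: vector_space free_scale by (rule vector_space_free_scale)
  have "tensor_class s n (p' + q') = tensor_class s n (p + q)"
    if "p' \<in> tensor_class s n p" "q' \<in> tensor_class s n q" for p' q'
    using that F.span_add[of "p' - p" "tensor_relations s n" "q' - q"]
    by (intro tensor_class_eqI) (simp add: tensor_class_def algebra_simps)
  then show ?thesis
    using tensor_class_self[OF assms(1), of s] tensor_class_self[OF assms(2), of s]
    unfolding tensor_add_def by blast
qed

lemma tensor_scale_class:
  assumes "p \<in> words n"
  shows "tensor_scale s n c (tensor_class s n p) = tensor_class s n (free_scale c p)"
proof -
  interpret F: vector_space free_scale by (rule vector_space_free_scale)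
  have "tensor_class s n (free_scale c p') = tensor_class s n (free_scale c p)"
    if "p' \<in> tensor_class s n p" for p'
    using that F.span_scale[of "p' - p" "tensor_relations s n" c]
    by (intro tensor_class_eqI) (simp add: tensor_class_def F.scale_right_diff_distrib)
  then show ?thesis
    using tensor_class_self[OF assms(1), of s]
    unfolding tensor_scale_def by blast
qed

lemma pure_closed: "length xs = n \<Longrightarrow> pure s xs \<in> tensor_power s n"
  by (auto simp: pure_def intro: tensor_class_closed words_single)

lemma tensor_lift_free_eval: "tensor_lift sM \<phi> u = free_eval sM \<phi> (SOME p. p \<in> u)"
  by (simp add: tensor_lift_def free_eval_def Let_def)

text \<open>The representative chosen for an element of the \<open>n\<close>-th power consists of words of length \<open>n\<close> only.\<close>

lemma tensor_lift_cong:
  assumes "u \<in> tensor_power s n" "\<And>xs. length xs = n \<Longrightarrow> \<phi> xs = \<psi> xs"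
  shows "tensor_lift sM \<phi> u = tensor_lift sM \<psi> u"
  unfolding tensor_lift_def Let_def
  by (rule sum.cong) (use tensor_rep(1)[OF assms(1)] assms(2) in \<open>auto simp: words_def\<close>)

lemma tensor_lift_class_multilinear:
  assumes "vector_space sM" "multilinear s sM n \<phi>" "p \<in> words n"
  shows "tensor_lift sM \<phi> (tensor_class s n p) = free_eval sM \<phi> p"
  by (rule tensor_lift_class[OF assms(1) _ assms(3)]) (rule multilinearD[OF assms(2)])

lemma tensor_lift_pure:
  assumes "vector_space sM" "multilinear s sM n \<phi>" "length xs = n"
  shows "tensor_lift sM \<phi> (pure s xs) = \<phi> xs"
proof -
  interpret M: vector_space sM by fact
  show ?thesis
    using tensor_lift_class_multilinear[OF assms(1,2) words_single[OF assms(3)]]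
    by (simp add: pure_def assms(3) free_eval_single[OF assms(1)])
qed

lemma tensor_lift_add:
  assumes "vector_space sM" "multilinear s sM n \<phi>" "u \<in> tensor_power s n" "v \<in> tensor_power s n"
  shows "tensor_lift sM \<phi> (tensor_add s n u v) = tensor_lift sM \<phi> u + tensor_lift sM \<phi> v"
proof -
  obtain p q where "p \<in> words n" "u = tensor_class s n p" "q \<in> words n" "v = tensor_class s n q"
    by (meson assms(3,4) tensor_powerE)
  then show ?thesis
    by (simp add: tensor_add_class tensor_lift_class_multilinear[OF assms(1,2)] words_add
        linear_plus[OF linear_free_eval[OF assms(1)]])
qed

lemma tensor_lift_scale:
  assumes "vector_space sM" "multilinear s sM n \<phi>" "u \<in> tensor_power s n"
  shows "tensor_lift sM \<phi> (tensor_scale s n c u) = sM c (tensor_lift sM \<phi> u)"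
proof -
  obtain p where "p \<in> words n" "u = tensor_class s n p"
    by (meson assms(3) tensor_powerE)
  then show ?thesis
    by (simp add: tensor_scale_class tensor_lift_class_multilinear[OF assms(1,2)] words_scale
        linear_scale[OF linear_free_eval[OF assms(1)]])
qed

lemma tensor_add_closed:
  "u \<in> tensor_power s n \<Longrightarrow> v \<in> tensor_power s n \<Longrightarrow> tensor_add s n u v \<in> tensor_power s n"
  by (metis tensor_add_class tensor_class_closed tensor_powerE words_add)

lemma tensor_scale_closed:
  "u \<in> tensor_power s n \<Longrightarrow> tensor_scale s n c u \<in> tensor_power s n"
  by (metis tensor_scale_class tensor_class_closed tensor_powerE words_scale)

lemma tensor_lift_tensor_closed:
  assumes "u \<in> tensor_power s m" "\<And>xs. length xs = m \<Longrightarrow> \<psi> xs \<in> tensor_power s' n"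
  shows "tensor_lift free_scale (\<lambda>xs. SOME p. p \<in> \<psi> xs) u \<in> words n"
    "tensor_lift_tensor s' n \<psi> u \<in> tensor_power s' n"
proof -
  show *: "tensor_lift free_scale (\<lambda>xs. SOME p. p \<in> \<psi> xs) u \<in> words n"
    unfolding tensor_lift_def Let_def
    by (intro words_sum words_scale tensor_rep(1)[OF assms(2)])
      (use tensor_rep(1)[OF assms(1)] in \<open>auto simp: words_def\<close>)
  show "tensor_lift_tensor s' n \<psi> u \<in> tensor_power s' n"
    unfolding tensor_lift_tensor_def by (rule tensor_class_closed[OF *])
qed

text \<open>A nested Sweedler expression may be evaluated from the inside out: the representatives chosen for
the inner tensors \<open>\<psi> xs\<close> are invisible to a multilinear \<open>\<phi>\<close>.\<close>

lemma tensor_lift_lift_tensor: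
  assumes "vector_space sM" "multilinear s' sM n \<phi>"
    and "u \<in> tensor_power s m" "\<And>xs. length xs = m \<Longrightarrow> \<psi> xs \<in> tensor_power s' n"
  shows "tensor_lift sM \<phi> (tensor_lift_tensor s' n \<psi> u) = tensor_lift sM (\<lambda>xs. tensor_lift sM \<phi> (\<psi> xs)) u"
proof -
  have "tensor_lift sM \<phi> (tensor_lift_tensor s' n \<psi> u)
      = free_eval sM \<phi> (tensor_lift free_scale (\<lambda>xs. SOME p. p \<in> \<psi> xs) u)"
    unfolding tensor_lift_tensor_def
    by (rule tensor_lift_class_multilinear[OF assms(1,2) tensor_lift_tensor_closed(1)[OF assms(3,4)]])
  also have "\<dots> = tensor_lift sM (\<lambda>xs. free_eval sM \<phi> (SOME p. p \<in> \<psi> xs)) u"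
    by (simp add: tensor_lift_def Let_def
      linear_sum[OF linear_free_eval[OF assms(1)]] linear_scale[OF linear_free_eval[OF assms(1)]])
  finally show ?thesis by (simp add: tensor_lift_free_eval[of sM \<phi>])
qed

lemma tensor_fun_hom:
  assumes "vector_space sM" "multilinear s sM n \<phi>"
  shows "tensor_fun s n sM \<phi> \<in> tensor_hom s n sM"
  by (simp add: tensor_hom_def tensor_fun_def tensor_lift_add[OF assms] tensor_lift_scale[OF assms]
      tensor_add_closed tensor_scale_closed)

lemma tensor_fun_pure:
  assumes "vector_space sM" "multilinear s sM n \<phi>" "length xs = n"
  shows "tensor_fun s n sM \<phi> (pure s xs) = \<phi> xs"
  by (simp add: tensor_fun_def pure_closed assms(3) tensor_lift_pure[OF assms])

lemma tensor_fun_cong: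
  assumes "\<And>xs. length xs = n \<Longrightarrow> \<phi> xs = \<psi> xs"
  shows "tensor_fun s n sM \<phi> = tensor_fun s n sM \<psi>"
  unfolding tensor_fun_def by (rule ext) (simp add: tensor_lift_cong[OF _ assms])

lemma pure_add:
  fixes s :: "'k::field \<Rightarrow> 'v::ab_group_add \<Rightarrow> 'v"
  assumes "length xs + length ys + 1 = n"
  shows "pure s (xs @ (a + b) # ys) = tensor_add s n (pure s (xs @ a # ys)) (pure s (xs @ b # ys))"
proof -
  interpret F: vector_space "free_scale :: 'k \<Rightarrow> ('v list \<Rightarrow>\<^sub>0 'k) \<Rightarrow> _" by (rule vector_space_free_scale)
  let ?e = "\<lambda>a. Poly_Mapping.single (xs @ a # ys) (1 :: 'k)"
  have "?e (a + b) - ?e a - ?e b \<in> tensor_relations s n"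
    using assms unfolding tensor_relations_def by blast
  then have "?e (a + b) - (?e a + ?e b) \<in> F.span (tensor_relations s n)"
    by (metis F.span_base diff_diff_eq)
  then show ?thesis
    using assms by (simp add: pure_def tensor_add_class words_single tensor_class_eqI)
qed

lemma pure_scale:
  fixes s :: "'k::field \<Rightarrow> 'v::ab_group_add \<Rightarrow> 'v"
  assumes "length xs + length ys + 1 = n"
  shows "pure s (xs @ s c a # ys) = tensor_scale s n c (pure s (xs @ a # ys))"
proof -
  interpret F: vector_space "free_scale :: 'k \<Rightarrow> ('v list \<Rightarrow>\<^sub>0 'k) \<Rightarrow> _" by (rule vector_space_free_scale)
  let ?e = "\<lambda>a. Poly_Mapping.single (xs @ a # ys) (1 :: 'k)"
  have "?e (s c a) - free_scale c (?e a) \<in> tensor_relations s n"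
    using assms unfolding tensor_relations_def by blast
  then show ?thesis
    using assms by (simp add: pure_def tensor_scale_class words_single tensor_class_eqI F.span_base)
qed

lemma tensor_hom_multilinear:
  fixes s :: "'k::field \<Rightarrow> 'v::ab_group_add \<Rightarrow> 'v"
  assumes "f \<in> tensor_hom s n sM" "vector_space s" "vector_space sM"
  shows "multilinear s sM n (\<lambda>xs. f (pure s xs))"
  unfolding multilinear_def
proof (intro allI impI)
  fix xs ys :: "'v list"
  assume len: "length xs + length ys + 1 = n"
  then have "pure s (xs @ a # ys) \<in> tensor_power s n" for a by (intro pure_closed) simp
  then show "Vector_Spaces.linear s sM (\<lambda>a. f (pure s (xs @ a # ys)))"
    using assms(1) by (intro linearI assms(2,3)) (simp_all add: pure_add[OF len] pure_scale[OF len] tensor_hom_def)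
qed

lemma poly_mapping_as_sum:
  "(\<Sum>xs\<in>Poly_Mapping.keys p. free_scale (Poly_Mapping.lookup p xs) (Poly_Mapping.single xs 1)) = p"
  by (rule poly_mapping_eqI) (simp add: lookup_sum lookup_single when_def in_keys_iff if_distrib[of "\<lambda>y. _ * y"] cong: if_cong)

text \<open>Pure tensors span, so a linear map is the lift of its own values on words.\<close>

lemma tensor_hom_eq_lift:
  fixes s :: "'k::field \<Rightarrow> 'v::ab_group_add \<Rightarrow> 'v"
  assumes f: "f \<in> tensor_hom s n sM" and sM: "vector_space sM" and u: "u \<in> tensor_power s n"
  shows "f u = tensor_lift sM (\<lambda>xs. f (pure s xs)) u"
proof -
  interpret M: vector_space sM by (rule sM)
  interpret F: vector_space free_scale by (rule vector_space_free_scale)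
  define p where "p = (SOME p. p \<in> u)"
  have p: "p \<in> words n" "u = tensor_class s n p"
    using tensor_rep[OF u] by (simp_all add: p_def)
  define e where "e xs = Poly_Mapping.single xs (1::'k)" for xs :: "'v list"
  have fadd: "f (tensor_add s n u v) = f u + f v"
    if "u \<in> tensor_power s n" "v \<in> tensor_power s n" for u v
    using f that unfolding tensor_hom_def by blast
  have fscale: "f (tensor_scale s n c u) = sM c (f u)" if "u \<in> tensor_power s n" for c u
    using f that unfolding tensor_hom_def by blast
  have zero: "f (tensor_class s n 0) = 0"
  proof -
    have "f (tensor_scale s n 0 (tensor_class s n 0)) = sM 0 (f (tensor_class s n 0))"
      by (rule fscale[OF tensor_class_closed[OF words_zero]])
    then show ?thesis by (simp add: tensor_scale_class[OF words_zero])
  qed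
  have "f (tensor_class s n (\<Sum>xs\<in>A. free_scale (c xs) (e xs))) = (\<Sum>xs\<in>A. sM (c xs) (f (pure s xs)))"
    if "finite A" "\<And>xs. xs \<in> A \<Longrightarrow> length xs = n" for A c
    using that
  proof (induction A)
    case empty
    then show ?case by (simp add: zero)
  next
    case (insert x A)
    have w: "e x \<in> words n" "free_scale (c x) (e x) \<in> words n" "(\<Sum>xs\<in>A. free_scale (c xs) (e xs)) \<in> words n"
      unfolding e_def using insert.prems by (auto intro!: words_sum words_scale words_single)
    have "f (tensor_class s n (free_scale (c x) (e x) + (\<Sum>xs\<in>A. free_scale (c xs) (e xs))))
        = f (tensor_class s n (free_scale (c x) (e x))) + f (tensor_class s n (\<Sum>xs\<in>A. free_scale (c xs) (e xs)))"
      using tensor_class_closed[OF w(2), of s] tensor_class_closed[OF w(3), of s]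
      by (simp add: fadd flip: tensor_add_class[OF w(2,3)])
    also have "f (tensor_class s n (free_scale (c x) (e x))) = sM (c x) (f (pure s x))"
      using insert.prems
      by (simp add: fscale tensor_class_closed[OF w(1)] pure_def flip: tensor_scale_class[OF w(1)] e_def)
    finally show ?case using insert by simp
  qed
  from this[of "Poly_Mapping.keys p" "Poly_Mapping.lookup p"] show ?thesis
    using p(1) arg_cong[OF p(2), of f]
    unfolding tensor_lift_def Let_def p_def[symmetric]
    by (simp add: e_def words_def poly_mapping_as_sum)
qed

lemma tensor_hom_eqI:
  assumes "f \<in> tensor_hom s n sM" "g \<in> tensor_hom s n sM" "vector_space sM"
    and "\<And>xs. length xs = n \<Longrightarrow> f (pure s xs) = g (pure s xs)"
  shows "f = g"
proof
  fix u
  show "f u = g u"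
  proof (cases "u \<in> tensor_power s n")
    case True
    show ?thesis
      unfolding tensor_hom_eq_lift[OF assms(1,3) True] tensor_hom_eq_lift[OF assms(2,3) True]
      by (rule tensor_lift_cong[OF True assms(4)])
  next
    case False
    then show ?thesis using assms(1,2) by (simp add: tensor_hom_def)
  qed
qed

section \<open>Linear operations on formal sums\<close>

lemma tensor_lift_map:
  assumes "Vector_Spaces.linear sM sN L"
  shows "L (tensor_lift sM \<phi> u) = tensor_lift sN (\<lambda>xs. L (\<phi> xs)) u"
  by (simp add: tensor_lift_def Let_def linear_sum[OF assms] linear_scale[OF assms])

lemma linear_tensor_lift:
  assumes "vector_space s" "vector_space sM" "\<And>xs. Vector_Spaces.linear s sM (\<lambda>z. \<phi> z xs)"
  shows "Vector_Spaces.linear s sM (\<lambda>z. tensor_lift sM (\<phi> z) u)"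
  unfolding tensor_lift_def Let_def using assms by (intro linear_combination) simp_all

text \<open>Independent Sweedler sums commute because both are finite sums over fixed representatives.\<close>

lemma tensor_lift_swap:
  assumes "vector_space sM"
  shows "tensor_lift sM (\<lambda>xs. tensor_lift sM (\<phi> xs) v) u = tensor_lift sM (\<lambda>ys. tensor_lift sM (\<lambda>xs. \<phi> xs ys) u) v"
proof -
  interpret M: vector_space sM by fact
  show ?thesis
    unfolding tensor_lift_def Let_def M.scale_sum_right
    by (subst sum.swap) (simp add: mult.commute)
qed

section \<open>Sweedler calculus\<close>

text \<open>The Sweedler sum of \<open>\<phi>(x\<^sub>(\<^sub>1\<^sub>), x\<^sub>(\<^sub>2\<^sub>))\<close>. Currying \<open>\<phi>\<close> keeps nested sums readable.\<close>

definition sweedler ::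
  "('k::field \<Rightarrow> 'm::ab_group_add \<Rightarrow> 'm) \<Rightarrow> ('d \<Rightarrow> ('k, 'd) tensor) \<Rightarrow> ('d \<Rightarrow> 'd \<Rightarrow> 'm) \<Rightarrow> 'd \<Rightarrow> 'm" where
  "sweedler sM \<Delta> \<phi> x = tensor_lift sM (\<lambda>xs. \<phi> (xs ! 0) (xs ! 1)) (\<Delta> x)"

text \<open>The Sweedler sum of \<open>\<phi> [x\<^sub>(\<^sub>1\<^sub>), \<dots>, x\<^sub>(\<^sub>n\<^sub>)]\<close>. It agrees with the lift along
\<^const>\<open>iterated_comult\<close> (\<open>iterated_comult_lift\<close> below), but starts one step earlier, with the
counit for the empty word. With this start, inductions on the number of factors need no separate
treatment of a single factor.\<close>

primrec sweedler_power ::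
  "('k::field \<Rightarrow> 'm::ab_group_add \<Rightarrow> 'm) \<Rightarrow> ('d \<Rightarrow> ('k, 'd) tensor) \<Rightarrow> ('d \<Rightarrow> 'k)
    \<Rightarrow> nat \<Rightarrow> ('d list \<Rightarrow> 'm) \<Rightarrow> 'd \<Rightarrow> 'm" where
  "sweedler_power sM \<Delta> \<epsilon> 0 = (\<lambda>\<phi> x. sM (\<epsilon> x) (\<phi> []))"
| "sweedler_power sM \<Delta> \<epsilon> (Suc n) =
     (\<lambda>\<phi> x. sweedler sM \<Delta> (\<lambda>a b. sweedler_power sM \<Delta> \<epsilon> n (\<lambda>xs. \<phi> (a # xs)) b) x)"

lemma multilinear_pairI:
  fixes s :: "'k::field \<Rightarrow> 'v::ab_group_add \<Rightarrow> 'v"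
  assumes "\<And>b. Vector_Spaces.linear s sM (\<lambda>a. \<phi> a b)" "\<And>a. Vector_Spaces.linear s sM (\<phi> a)"
  shows "multilinear s sM 2 (\<lambda>xs. \<phi> (xs ! 0) (xs ! 1))"
  unfolding multilinear_def
proof (intro allI impI)
  fix xs ys :: "'v list"
  assume "length xs + length ys + 1 = 2"
  then consider b where "xs = []" "ys = [b]" | a where "xs = [a]" "ys = []"
    by (cases xs; cases ys) auto
  then show "Vector_Spaces.linear s sM (\<lambda>a. \<phi> ((xs @ a # ys) ! 0) ((xs @ a # ys) ! 1))"
    by cases (simp_all add: assms)
qed

lemma multilinear_tripleI:
  fixes s :: "'k::field \<Rightarrow> 'v::ab_group_add \<Rightarrow> 'v"
  assumes "\<And>b c. Vector_Spaces.linear s sM (\<lambda>a. \<phi> a b c)" "\<And>a c. Vector_Spaces.linear s sM (\<lambda>b. \<phi> a b c)"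
    "\<And>a b. Vector_Spaces.linear s sM (\<phi> a b)"
  shows "multilinear s sM 3 (\<lambda>xs. \<phi> (xs ! 0) (xs ! 1) (xs ! 2))"
  unfolding multilinear_def
proof (intro allI impI)
  fix xs ys :: "'v list"
  assume "length xs + length ys + 1 = 3"
  then consider b c where "xs = []" "ys = [b, c]" | a c where "xs = [a]" "ys = [c]"
    | a b where "xs = [a, b]" "ys = []"
    by (cases xs; cases ys; cases "tl xs"; cases "tl ys") auto
  then show "Vector_Spaces.linear s sM (\<lambda>a. \<phi> ((xs @ a # ys) ! 0) ((xs @ a # ys) ! 1) ((xs @ a # ys) ! 2))"
    by cases (simp_all add: assms numeral_2_eq_2)
qed

lemma sweedler_cong:
  assumes "\<And>a b. \<phi> a b = \<psi> a b"
  shows "sweedler sM \<Delta> \<phi> x = sweedler sM \<Delta> \<psi> x"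
  unfolding sweedler_def assms ..

lemma sweedler_map:
  assumes "Vector_Spaces.linear sM sN L"
  shows "L (sweedler sM \<Delta> \<phi> x) = sweedler sN \<Delta> (\<lambda>a b. L (\<phi> a b)) x"
  unfolding sweedler_def by (rule tensor_lift_map[OF assms])

text \<open>Here \<open>\<phi>\<close> depends on a parameter \<open>z\<close>; linearity in the comultiplied element itself is
\<open>linear_sweedler_self\<close> below.\<close>

lemma linear_sweedler:
  assumes "vector_space s" "vector_space sM" "\<And>a b. Vector_Spaces.linear s sM (\<lambda>z. \<phi> z a b)"
  shows "Vector_Spaces.linear s sM (\<lambda>z. sweedler sM \<Delta> (\<phi> z) x)"
  unfolding sweedler_def by (rule linear_tensor_lift[OF assms])

lemma sweedler_swap:
  assumes "vector_space sM"
  shows "sweedler sM \<Delta> (\<lambda>a b. sweedler sM \<Delta>' (\<phi> a b) y) x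
       = sweedler sM \<Delta>' (\<lambda>c d. sweedler sM \<Delta> (\<lambda>a b. \<phi> a b c d) x) y"
  unfolding sweedler_def by (rule tensor_lift_swap[OF assms])

lemma sweedler_power_cong:
  assumes "\<And>xs. length xs = n \<Longrightarrow> \<phi> xs = \<psi> xs"
  shows "sweedler_power sM \<Delta> \<epsilon> n \<phi> x = sweedler_power sM \<Delta> \<epsilon> n \<psi> x"
  using assms
proof (induction n arbitrary: \<phi> \<psi> x)
  case (Suc n)
  have "sweedler_power sM \<Delta> \<epsilon> n (\<lambda>xs. \<phi> (a # xs)) = sweedler_power sM \<Delta> \<epsilon> n (\<lambda>xs. \<psi> (a # xs))" for a
    by (rule ext, rule Suc.IH) (simp add: Suc.prems)
  then show ?case by simp
qed simp

lemma linear_sweedler_power: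
  assumes "vector_space s" "vector_space sM" "\<And>xs. length xs = n \<Longrightarrow> Vector_Spaces.linear s sM (\<lambda>z. \<phi> z xs)"
  shows "Vector_Spaces.linear s sM (\<lambda>z. sweedler_power sM \<Delta> \<epsilon> n (\<phi> z) x)"
  using assms(3)
proof (induction n arbitrary: \<phi> x)
  case 0
  then show ?case by (simp add: linear_scaled[of s sM "\<lambda>z. \<phi> z []"])
next
  case (Suc n)
  show ?case
    unfolding sweedler_power.simps
    by (intro linear_sweedler assms(1,2) Suc.IH Suc.prems) simp
qed

lemma sweedler_power_map:
  assumes "Vector_Spaces.linear sM sN L"
  shows "L (sweedler_power sM \<Delta> \<epsilon> n \<phi> x) = sweedler_power sN \<Delta> \<epsilon> n (\<lambda>xs. L (\<phi> xs)) x"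
  by (induction n arbitrary: \<phi> x) (simp_all add: linear_scale[OF assms] sweedler_map[OF assms])

lemma sweedler_power_swap:
  assumes "vector_space sM"
  shows "sweedler_power sM \<Delta> \<epsilon> n (\<lambda>xs. sweedler sM \<Delta>' (\<phi> xs) y) x
       = sweedler sM \<Delta>' (\<lambda>c d. sweedler_power sM \<Delta> \<epsilon> n (\<lambda>xs. \<phi> xs c d) x) y"
proof (induction n arbitrary: \<phi> x)
  case 0
  have "Vector_Spaces.linear sM sM (sM c)" for c
    using linear_scaled[OF linear_identity[OF assms]] .
  then show ?case by (simp add: sweedler_map[of sM sM "sM (\<epsilon> x)"])
next
  case (Suc n)
  have "sweedler_power sM \<Delta> \<epsilon> n (\<lambda>xs. sweedler sM \<Delta>' (\<phi> (a # xs)) y)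
      = (\<lambda>b. sweedler sM \<Delta>' (\<lambda>c d. sweedler_power sM \<Delta> \<epsilon> n (\<lambda>xs. \<phi> (a # xs) c d) b) y)" for a
    by (rule ext) (rule Suc.IH)
  then show ?case by (simp add: sweedler_swap[OF assms, of \<Delta> \<Delta>'])
qed

context coalgebra
begin

lemma linear_sweedler_self:
  assumes "vector_space sM" "\<And>b. Vector_Spaces.linear scale sM (\<lambda>a. \<phi> a b)"
    "\<And>a. Vector_Spaces.linear scale sM (\<phi> a)"
  shows "Vector_Spaces.linear scale sM (sweedler sM \<Delta> \<phi>)"
  unfolding sweedler_def
  by (rule linearI[OF vector_space_axioms assms(1)])
    (simp_all add: comult_add comult_scale comult_closed tensor_lift_add[OF assms(1) multilinear_pairI[OF assms(2,3)]]
       tensor_lift_scale[OF assms(1) multilinear_pairI[OF assms(2,3)]] del: One_nat_def)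

text \<open>Coassociativity is an equation in the third tensor power; applying the linear map that a trilinear
\<open>\<phi>\<close> induces there gives the rule for sums.\<close>

lemma sweedler_coassoc:
  assumes sM: "vector_space sM"
    and lin: "\<And>b c. Vector_Spaces.linear scale sM (\<lambda>a. \<phi> a b c)"
      "\<And>a c. Vector_Spaces.linear scale sM (\<lambda>b. \<phi> a b c)"
      "\<And>a b. Vector_Spaces.linear scale sM (\<phi> a b)"
  shows "sweedler sM \<Delta> (\<lambda>y c. sweedler sM \<Delta> (\<lambda>a b. \<phi> a b c) y) x
       = sweedler sM \<Delta> (\<lambda>a y. sweedler sM \<Delta> (\<phi> a) y) x"
proof -
  let ?\<Phi> = "\<lambda>xs. \<phi> (xs ! 0) (xs ! 1) (xs ! 2)"
  have ml: "multilinear scale sM 3 ?\<Phi>" by (rule multilinear_tripleI[OF lin])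
  have cl: "tensor_lift_tensor scale 3 \<psi> (\<Delta> y) \<in> tensor_power scale 3"
    if "\<And>ys. \<psi> ys \<in> tensor_power scale 3" for \<psi> y
    by (rule tensor_lift_tensor_closed(2)[OF comult_closed that])
  have lift: "tensor_lift sM ?\<Phi> (tensor_lift_tensor scale 3 \<psi> (\<Delta> y)) = tensor_lift sM (\<lambda>xs. tensor_lift sM ?\<Phi> (\<psi> xs)) (\<Delta> y)"
    if "\<And>ys. \<psi> ys \<in> tensor_power scale 3" for \<psi> y
    by (rule tensor_lift_lift_tensor[OF sM ml comult_closed that])
  from arg_cong[OF coassoc[of x], of "tensor_lift sM ?\<Phi>"] show ?thesis
    by (simp add: lift cl pure_closed tensor_lift_pure[OF sM ml] sweedler_def del: One_nat_def)
qed

lemma sweedler_counit_left: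
  assumes "Vector_Spaces.linear scale sM \<phi>"
  shows "sweedler sM \<Delta> (\<lambda>a b. sM (\<epsilon> a) (\<phi> b)) x = \<phi> x"
  using arg_cong[OF counit_left[of x], of \<phi>]
  by (simp add: tensor_lift_map[OF assms] linear_scale[OF assms] sweedler_def del: One_nat_def)

lemma sweedler_counit_right:
  assumes "Vector_Spaces.linear scale sM \<phi>"
  shows "sweedler sM \<Delta> (\<lambda>a b. sM (\<epsilon> b) (\<phi> a)) x = \<phi> x"
  using arg_cong[OF counit_right[of x], of \<phi>]
  by (simp add: tensor_lift_map[OF assms] linear_scale[OF assms] sweedler_def del: One_nat_def)

abbreviation "iter_sum sM \<equiv> sweedler_power sM \<Delta> \<epsilon>"

lemma linear_sweedler_power_self:
  assumes sM: "vector_space sM"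
  shows "multilinear scale sM n \<phi> \<Longrightarrow> Vector_Spaces.linear scale sM (iter_sum sM n \<phi>)"
proof (induction n arbitrary: \<phi>)
  case 0
  then show ?case by (simp add: linear_scalar_times[OF counit_linear sM])
next
  case (Suc n)
  show ?case
    unfolding sweedler_power.simps
    by (intro linear_sweedler_self[OF sM] linear_sweedler_power vector_space_axioms sM
          Suc.IH multilinear_Cons[OF Suc.prems])
      (use multilinearD[OF Suc.prems, of "[]"] in simp)
qed

lemma sweedler_power_one:
  assumes "multilinear scale sM 1 \<phi>"
  shows "iter_sum sM 1 \<phi> x = \<phi> [x]"
  using sweedler_counit_right[OF multilinearD[OF assms, of "[]" "[]"]] by simp

lemma iterated_comult_closed: "iterated_comult scale \<Delta> n x \<in> tensor_power scale (Suc n)"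
proof (induction n arbitrary: x)
  case 0
  then show ?case by (simp add: pure_closed)
next
  case (Suc n)
  show ?case
    unfolding iterated_comult.simps add_2_eq_Suc'
    by (rule tensor_lift_tensor_closed(2)[OF comult_closed tensor_lift_tensor_closed(2)[OF Suc pure_closed]]) simp
qed

lemma iterated_comult_lift:
  assumes sM: "vector_space sM"
  shows "multilinear scale sM (Suc n) \<phi> \<Longrightarrow> tensor_lift sM \<phi> (iterated_comult scale \<Delta> n x) = iter_sum sM (Suc n) \<phi> x"
proof (induction n arbitrary: \<phi> x)
  case 0
  then show ?case
    using sweedler_power_one[of sM \<phi> x] by (simp add: tensor_lift_pure[OF sM] del: sweedler_power.simps)
next
  case (Suc n)
  have cl: "tensor_lift_tensor scale (n + 2) (\<lambda>ys. pure scale (xs ! 0 # ys)) (iterated_comult scale \<Delta> n (xs ! 1))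
      \<in> tensor_power scale (n + 2)" for xs
    by (rule tensor_lift_tensor_closed(2)[OF iterated_comult_closed pure_closed]) simp
  have ml: "multilinear scale sM (n + 2) \<phi>" using Suc.prems by simp
  have "tensor_lift sM \<phi> (tensor_lift_tensor scale (n + 2) (\<lambda>ys. pure scale (xs ! 0 # ys)) (iterated_comult scale \<Delta> n (xs ! 1)))
      = iter_sum sM (Suc n) (\<lambda>ys. \<phi> (xs ! 0 # ys)) (xs ! 1)" for xs
  proof -
    have "tensor_lift sM \<phi> (tensor_lift_tensor scale (n + 2) (\<lambda>ys. pure scale (xs ! 0 # ys)) (iterated_comult scale \<Delta> n (xs ! 1)))
        = tensor_lift sM (\<lambda>ys. tensor_lift sM \<phi> (pure scale (xs ! 0 # ys))) (iterated_comult scale \<Delta> n (xs ! 1))"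
      by (rule tensor_lift_lift_tensor[OF sM ml iterated_comult_closed pure_closed]) simp
    also have "\<dots> = tensor_lift sM (\<lambda>ys. \<phi> (xs ! 0 # ys)) (iterated_comult scale \<Delta> n (xs ! 1))"
      by (rule tensor_lift_cong[OF iterated_comult_closed]) (simp add: tensor_lift_pure[OF sM ml])
    finally show ?thesis by (simp only: Suc.IH[OF multilinear_Cons[OF Suc.prems]])
  qed
  then show ?case
    unfolding iterated_comult.simps sweedler_power.simps(2)[of sM \<Delta> \<epsilon> "Suc n"] sweedler_def[of sM \<Delta> _ x]
    by (simp only: tensor_lift_lift_tensor[OF sM ml comult_closed cl])
qed

text \<open>Comultiplying any one of the \<open>n\<close> Sweedler factors yields the \<open>n + 1\<close> factors. At position \<open>0\<close> this is
coassociativity, and the other positions lie under the first factor, which the recursion removes.\<close>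

lemma sweedler_power_split:
  assumes sM: "vector_space sM"
  shows "multilinear scale sM (Suc n) \<phi> \<Longrightarrow> i < n \<Longrightarrow>
    iter_sum sM n (\<lambda>xs. sweedler sM \<Delta> (\<lambda>a b. \<phi> (take i xs @ a # b # drop (Suc i) xs)) (xs ! i)) x = iter_sum sM (Suc n) \<phi> x"
proof (induction n arbitrary: \<phi> i x)
  case (Suc n)
  show ?case
  proof (cases i)
    case 0
    have lin: "Vector_Spaces.linear scale sM (\<lambda>a. iter_sum sM n (\<lambda>xs. \<phi> (a # b # xs)) c)"
      "Vector_Spaces.linear scale sM (\<lambda>b. iter_sum sM n (\<lambda>xs. \<phi> (a # b # xs)) c)"
      "Vector_Spaces.linear scale sM (\<lambda>c. iter_sum sM n (\<lambda>xs. \<phi> (a # b # xs)) c)" for a b c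
      subgoal
        by (intro linear_sweedler_power vector_space_axioms sM)
          (use multilinearD[OF Suc.prems(1), of "[]"] in simp)
      subgoal
        by (intro linear_sweedler_power vector_space_axioms sM)
          (use multilinearD[OF Suc.prems(1), of "[a]"] in simp)
      subgoal by (intro linear_sweedler_power_self sM multilinear_Cons Suc.prems)
      done
    have "iter_sum sM (Suc n) (\<lambda>xs. sweedler sM \<Delta> (\<lambda>a b. \<phi> (take i xs @ a # b # drop (Suc i) xs)) (xs ! i)) x
        = sweedler sM \<Delta> (\<lambda>y c. sweedler sM \<Delta> (\<lambda>a b. iter_sum sM n (\<lambda>xs. \<phi> (a # b # xs)) c) y) x"
      unfolding sweedler_power.simps by (rule sweedler_cong) (simp add: 0 sweedler_power_swap[OF sM])
    also have "\<dots> = iter_sum sM (Suc (Suc n)) \<phi> x"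
      unfolding sweedler_power.simps by (rule sweedler_coassoc[OF sM lin])
    finally show ?thesis .
  next
    case (Suc j)
    show ?thesis
      unfolding sweedler_power.simps(2)[of sM \<Delta> \<epsilon> n] sweedler_power.simps(2)[of sM \<Delta> \<epsilon> "Suc n"]
      by (rule sweedler_cong)
        (use Suc.IH[OF multilinear_Cons[OF Suc.prems(1)], of j] Suc.prems(2) Suc in simp)
  qed
qed simp

text \<open>Dual to \<open>sweedler_power_split\<close>, by the same induction: at position \<open>0\<close> this is the left counit axiom, and
the other positions lie under the first factor.\<close>

lemma sweedler_power_counit:
  assumes sM: "vector_space sM"
  shows "multilinear scale sM n \<phi> \<Longrightarrow> i \<le> n \<Longrightarrow>
    iter_sum sM (Suc n) (\<lambda>xs. sM (\<epsilon> (xs ! i)) (\<phi> (take i xs @ drop (Suc i) xs))) x = iter_sum sM n \<phi> x"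
proof (induction i arbitrary: n \<phi> x)
  case 0
  have "iter_sum sM n (\<lambda>xs. sM c (\<phi> xs)) b = sM c (iter_sum sM n \<phi> b)" for b c
    by (rule sweedler_power_map[OF linear_scaled[OF linear_identity[OF sM]], symmetric])
  then have "iter_sum sM (Suc n) (\<lambda>xs. sM (\<epsilon> (xs ! 0)) (\<phi> (take 0 xs @ drop (Suc 0) xs))) x
      = sweedler sM \<Delta> (\<lambda>a b. sM (\<epsilon> a) (iter_sum sM n \<phi> b)) x"
    unfolding sweedler_power.simps by (intro sweedler_cong) simp
  also have "\<dots> = iter_sum sM n \<phi> x"
    by (rule sweedler_counit_left[OF linear_sweedler_power_self[OF sM 0(1)]])
  finally show ?case .
next
  case (Suc i)
  then obtain m where n: "n = Suc m" by (cases n) auto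
  have "iter_sum sM (Suc m) (\<lambda>xs. sM (\<epsilon> (xs ! i)) (\<phi> (a # take i xs @ drop (Suc i) xs))) b
      = iter_sum sM m (\<lambda>xs. \<phi> (a # xs)) b" for a b
    by (rule Suc.IH[of m, OF multilinear_Cons]) (use Suc.prems n in simp_all)
  then have "iter_sum sM (Suc (Suc m)) (\<lambda>xs. sM (\<epsilon> (xs ! Suc i)) (\<phi> (take (Suc i) xs @ drop (Suc (Suc i)) xs))) x
      = sweedler sM \<Delta> (\<lambda>a b. iter_sum sM m (\<lambda>xs. \<phi> (a # xs)) b) x"
    unfolding sweedler_power.simps(2)[of sM \<Delta> \<epsilon> "Suc m"]
    by (intro sweedler_cong) (simp del: sweedler_power.simps)
  also have "\<dots> = iter_sum sM (Suc m) \<phi> x" by simp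
  finally show ?case by (simp only: n)
qed

text \<open>The recursion for \<^const>\<open>sweedler_power\<close> splits off the first factor; by coassociativity the last one
can be split off instead.\<close>

lemma sweedler_power_snoc:
  assumes sM: "vector_space sM"
  shows "multilinear scale sM (Suc n) \<phi> \<Longrightarrow>
    sweedler sM \<Delta> (\<lambda>a b. iter_sum sM n (\<lambda>xs. \<phi> (xs @ [b])) a) x = iter_sum sM (Suc n) \<phi> x"
proof (induction n arbitrary: \<phi> x)
  case 0
  then show ?case
    using sweedler_counit_left[OF multilinearD[of scale sM "Suc 0" \<phi> "[]" "[]"]] sweedler_power_one[of sM \<phi> x] by simp
next
  case (Suc n)
  have ml: "multilinear scale sM n (\<lambda>xs. \<phi> (a # xs @ [c]))" for a c
    using multilinear_append[of scale sM "[a]" n "[c]"] Suc.prems by simp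
  have lin: "Vector_Spaces.linear scale sM (\<lambda>a. iter_sum sM n (\<lambda>xs. \<phi> (a # xs @ [c])) b)"
      "Vector_Spaces.linear scale sM (\<lambda>b. iter_sum sM n (\<lambda>xs. \<phi> (a # xs @ [c])) b)"
      "Vector_Spaces.linear scale sM (\<lambda>c. iter_sum sM n (\<lambda>xs. \<phi> (a # xs @ [c])) b)" for a b c
    subgoal
      by (intro linear_sweedler_power vector_space_axioms sM)
        (use multilinearD[OF Suc.prems(1), of "[]"] in simp)
    subgoal by (intro linear_sweedler_power_self sM ml)
    subgoal
      by (intro linear_sweedler_power vector_space_axioms sM)
        (use multilinearD[OF Suc.prems(1), of "a # _" "[]"] in simp)
    done
  have "sweedler sM \<Delta> (\<lambda>a b. iter_sum sM (Suc n) (\<lambda>xs. \<phi> (xs @ [b])) a) x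
      = sweedler sM \<Delta> (\<lambda>a y. sweedler sM \<Delta> (\<lambda>b c. iter_sum sM n (\<lambda>xs. \<phi> (a # xs @ [c])) b) y) x"
    using sweedler_coassoc[OF sM lin, of x] by simp
  also have "\<dots> = iter_sum sM (Suc (Suc n)) \<phi> x"
    unfolding sweedler_power.simps(2)[of sM \<Delta> \<epsilon> "Suc n"]
    by (rule sweedler_cong) (use Suc.IH[OF multilinear_Cons[OF Suc.prems]] in simp)
  finally show ?case .
qed

end

context hopf_algebra
begin

lemma sweedler_antipode:
  assumes "Vector_Spaces.linear scale sM \<phi>"
  shows "sweedler sM \<Delta> (\<lambda>a b. \<phi> (a * S b)) x = sM (\<epsilon> x) (\<phi> 1)"
  using arg_cong[OF antipode_right[of x], of \<phi>]
  by (simp add: tensor_lift_map[OF assms] linear_scale[OF assms] sweedler_def del: One_nat_def)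

text \<open>The last two of \<open>n + 2\<close> factors arise by comultiplying the last of \<open>n + 1\<close>, so multiplying the first of
them with the antipode of the second leaves a counit, which disappears. The induction strips the
leading factors until only these two remain.\<close>

lemma sweedler_power_antipode:
  assumes sM: "vector_space sM"
    and "\<And>xs. length xs = n \<Longrightarrow> Vector_Spaces.linear scale sM (\<phi> xs)"
  shows "iter_sum sM (Suc (Suc n)) (\<lambda>xs. \<phi> (take n xs) (xs ! n * S (xs ! Suc n))) x = iter_sum sM n (\<lambda>xs. \<phi> xs 1) x"
  using assms(2)
proof (induction n arbitrary: \<phi> x)
  case 0
  have "Vector_Spaces.linear scale sM (\<lambda>b. \<phi> [] (a * S b))" for a
    by (intro linear_comp[OF 0[of "[]"]] linearI vector_space_axioms)
      (simp_all add: linear_plus[OF antipode_linear] linear_scale[OF antipode_linear] distrib_left scale_mult_right)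
  from sweedler_counit_right[OF this]
  have "sweedler sM \<Delta> (\<lambda>b c. sM (\<epsilon> c) (\<phi> [] (a * S b))) = (\<lambda>b. \<phi> [] (a * S b))" for a
    by (rule ext)
  then show ?case
    using sweedler_antipode[OF 0[of "[]"]] by simp
next
  case (Suc n)
  show ?case
    unfolding sweedler_power.simps(2)[of sM \<Delta> \<epsilon> "Suc (Suc n)"] sweedler_power.simps(2)[of sM \<Delta> \<epsilon> n]
    by (rule sweedler_cong) (use Suc.IH[of "\<lambda>xs. \<phi> (_ # xs)"] Suc.prems in simp)
qed

end

context right_contramodule
begin

text \<open>The structure map \<open>\<alpha>\<close> is linear on linear maps only, so each term of the combination has to be linear
in the free argument before \<open>\<alpha>\<close> may be interchanged with a sum.\<close>

lemma contra_combination: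
  assumes "finite A" "\<And>x. x \<in> A \<Longrightarrow> Vector_Spaces.linear sD sM (\<lambda>h. \<phi> h x)"
  shows "\<alpha> (\<lambda>h. \<Sum>x\<in>A. sM (c x) (\<phi> h x)) = (\<Sum>x\<in>A. sM (c x) (\<alpha> (\<lambda>h. \<phi> h x)))"
  using assms
proof (induction A)
  case empty
  have "Vector_Spaces.linear sD sM (\<lambda>x. 0)"
    by (rule linearI) (simp_all add: D.vector_space_axioms M.vector_space_axioms)
  from contra_scale[OF this, of 0] show ?case by simp
next
  case (insert x A)
  have "Vector_Spaces.linear sD sM (\<lambda>h. \<Sum>x\<in>A. sM (c x) (\<phi> h x))"
    using insert by (intro linear_combination) (simp_all add: D.vector_space_axioms M.vector_space_axioms)
  moreover have "Vector_Spaces.linear sD sM (\<lambda>h. sM (c x) (\<phi> h x))"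
    by (intro linear_scaled insert.prems) simp
  ultimately have "\<alpha> (\<lambda>h. sM (c x) (\<phi> h x) + (\<Sum>x\<in>A. sM (c x) (\<phi> h x)))
      = \<alpha> (\<lambda>h. sM (c x) (\<phi> h x)) + \<alpha> (\<lambda>h. \<Sum>x\<in>A. sM (c x) (\<phi> h x))"
    by (intro contra_add)
  then show ?case using insert by (simp add: contra_scale)
qed

lemma contra_sweedler:
  assumes "\<And>a b. Vector_Spaces.linear sD sM (\<lambda>h. \<phi> h a b)"
  shows "\<alpha> (\<lambda>h. sweedler sM \<Delta>' (\<phi> h) x) = sweedler sM \<Delta>' (\<lambda>a b. \<alpha> (\<lambda>h. \<phi> h a b)) x"
  unfolding sweedler_def tensor_lift_def Let_def by (rule contra_combination) (simp_all add: assms)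

lemma contra_sweedler_power:
  assumes "\<And>xs. length xs = n \<Longrightarrow> Vector_Spaces.linear sD sM (\<lambda>h. \<phi> h xs)"
  shows "\<alpha> (\<lambda>h. sweedler_power sM \<Delta>' \<epsilon>' n (\<phi> h) x) = sweedler_power sM \<Delta>' \<epsilon>' n (\<lambda>xs. \<alpha> (\<lambda>h. \<phi> h xs)) x"
  using assms
proof (induction n arbitrary: \<phi> x)
  case 0
  then show ?case by (simp add: contra_scale)
next
  case (Suc n)
  have "\<alpha> (\<lambda>h. sweedler sM \<Delta>' (\<lambda>a b. sweedler_power sM \<Delta>' \<epsilon>' n (\<lambda>xs. \<phi> h (a # xs)) b) x)
      = sweedler sM \<Delta>' (\<lambda>a b. \<alpha> (\<lambda>h. sweedler_power sM \<Delta>' \<epsilon>' n (\<lambda>xs. \<phi> h (a # xs)) b)) x"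
    by (intro contra_sweedler linear_sweedler_power D.vector_space_axioms M.vector_space_axioms Suc.prems) simp
  also have "\<dots> = sweedler sM \<Delta>' (\<lambda>a b. sweedler_power sM \<Delta>' \<epsilon>' n (\<lambda>xs. \<alpha> (\<lambda>h. \<phi> h (a # xs))) b) x"
    using Suc.IH[of "\<lambda>h xs. \<phi> h (_ # xs)"] Suc.prems by simp
  finally show ?case by simp
qed

text \<open>Contraassociativity for bilinear functions in place of linear maps on the tensor square. It merges two
applications of \<open>\<alpha>\<close> into one and is the source of the formula for the powers of the cyclic operator.\<close>

lemma contra_assoc_sweedler:
  assumes "\<And>b. Vector_Spaces.linear sD sM (\<lambda>a. \<phi> a b)" "\<And>a. Vector_Spaces.linear sD sM (\<phi> a)"
  shows "\<alpha> (\<lambda>x. \<alpha> (\<phi> x)) = \<alpha> (sweedler sM \<Delta> \<phi>)"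
proof -
  let ?F = "tensor_fun sD 2 sM (\<lambda>xs. \<phi> (xs ! 0) (xs ! 1))"
  have ml: "multilinear sD sM 2 (\<lambda>xs. \<phi> (xs ! 0) (xs ! 1))" by (rule multilinear_pairI[OF assms])
  have "?F (pure sD [x, y]) = \<phi> x y" for x y
    using tensor_fun_pure[OF M.vector_space_axioms ml, of "[x, y]"] by simp
  moreover have "?F (\<Delta> x) = sweedler sM \<Delta> \<phi> x" for x
    by (simp add: tensor_fun_def D.comult_closed sweedler_def)
  ultimately show ?thesis
    using contra_assoc[OF tensor_fun_hom[OF M.vector_space_axioms ml]] by simp
qed

end

lemma sweedler_add:
  assumes "vector_space sM"
  shows "sweedler sM \<Delta> (\<lambda>a b. \<phi> a b + \<psi> a b) x = sweedler sM \<Delta> \<phi> x + sweedler sM \<Delta> \<psi> x"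
proof -
  interpret M: vector_space sM by fact
  show ?thesis by (simp add: sweedler_def tensor_lift_def Let_def M.scale_right_distrib sum.distrib)
qed

lemma sweedler_scaled:
  assumes "vector_space sM"
  shows "sweedler sM \<Delta> (\<lambda>a b. sM c (\<phi> a b)) x = sM c (sweedler sM \<Delta> \<phi> x)"
  by (rule sweedler_map[OF linear_scaled[OF linear_identity[OF assms]], symmetric])

lemma sweedler_power_add:
  assumes "vector_space sM"
  shows "sweedler_power sM \<Delta> \<epsilon> n (\<lambda>xs. \<phi> xs + \<psi> xs) x = sweedler_power sM \<Delta> \<epsilon> n \<phi> x + sweedler_power sM \<Delta> \<epsilon> n \<psi> x"
proof (induction n arbitrary: \<phi> \<psi> x)
  case 0
  interpret M: vector_space sM by fact
  show ?case by (simp add: M.scale_right_distrib)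
next
  case (Suc n)
  show ?case
    unfolding sweedler_power.simps sweedler_add[OF assms, symmetric] by (rule sweedler_cong) (rule Suc)
qed

lemma multilinear_sweedler:
  assumes "vector_space s" "vector_space sM" "\<And>a b. multilinear s sM n (\<lambda>xs. \<phi> xs a b)"
  shows "multilinear s sM n (\<lambda>xs. sweedler sM \<Delta> (\<phi> xs) x)"
  unfolding multilinear_def by (intro allI impI linear_sweedler assms(1,2) multilinearD[OF assms(3)])

lemma multilinear_sweedler_power:
  assumes "vector_space s" "vector_space sM" "\<And>hs. length hs = m \<Longrightarrow> multilinear s sM n (\<lambda>xs. \<phi> xs hs)"
  shows "multilinear s sM n (\<lambda>xs. sweedler_power sM \<Delta> \<epsilon> m (\<phi> xs) x)"
  unfolding multilinear_def by (intro allI impI linear_sweedler_power assms(1,2) multilinearD[OF assms(3)])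

lemma (in coalgebra) sweedler_power_two:
  assumes "vector_space sM" "multilinear scale sM 2 \<phi>"
  shows "iter_sum sM 2 \<phi> x = sweedler sM \<Delta> (\<lambda>a b. \<phi> [a, b]) x"
proof -
  have "multilinear scale sM 1 (\<lambda>xs. \<phi> (xs @ [b]))" for b
    using multilinear_append[of scale sM "[]" 1 "[b]"] assms(2) by (simp add: numeral_2_eq_2)
  then have "iter_sum sM 1 (\<lambda>xs. \<phi> (xs @ [b])) a = \<phi> [a, b]" for a b
    by (simp add: sweedler_power_one del: sweedler_power.simps One_nat_def)
  then show ?thesis
    using sweedler_power_snoc[OF assms(1), of 1 \<phi> x] assms(2) by (simp add: numeral_2_eq_2)
qed

lemma (in right_contramodule) linear_contra:
  assumes "vector_space s" "\<And>z. Vector_Spaces.linear sD sM (\<phi> z)" "\<And>h. Vector_Spaces.linear s sM (\<lambda>z. \<phi> z h)"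
  shows "Vector_Spaces.linear s sM (\<lambda>z. \<alpha> (\<phi> z))"
proof (rule linearI[OF assms(1) M.vector_space_axioms])
  show "\<alpha> (\<phi> (x + y)) = \<alpha> (\<phi> x) + \<alpha> (\<phi> y)" for x y
  proof -
    have "\<phi> (x + y) = (\<lambda>h. \<phi> x h + \<phi> y h)" by (rule ext) (rule linear_plus[OF assms(3)])
    then show ?thesis using contra_add[OF assms(2)[of x] assms(2)[of y]] by simp
  qed
  show "\<alpha> (\<phi> (s c x)) = sM c (\<alpha> (\<phi> x))" for c x
  proof -
    have "\<phi> (s c x) = (\<lambda>h. sM c (\<phi> x h))" by (rule ext) (rule linear_scale[OF assms(3)])
    then show ?thesis using contra_scale[OF assms(2)[of x]] by simp
  qed
qed

lemma split_at:
  assumes "i < length xs"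
  obtains us c vs where "xs = us @ c # vs" "length us = i"
  using id_take_nth_drop[OF assms] assms by (metis length_take less_imp_le min.absorb2)

lemma nth_middle: "length us = i \<Longrightarrow> (us @ c # vs) ! i = c"
  by auto

section \<open>Equivariant cochains on words\<close>

locale contramodule_cochains =
  C: module_coalgebra sH \<Delta>H \<epsilon>H S sC \<Delta>C \<epsilon>C actC + M: stable_ayd_contramodule sH \<Delta>H \<epsilon>H S sM actM \<alpha>
  for sH :: "'k::field \<Rightarrow> 'h::ring_1 \<Rightarrow> 'h" and \<Delta>H \<epsilon>H S
    and sC :: "'k \<Rightarrow> 'c::ab_group_add \<Rightarrow> 'c" and \<Delta>C \<epsilon>C actC
    and sM :: "'k \<Rightarrow> 'm::ab_group_add \<Rightarrow> 'm" and actM \<alpha>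
begin

abbreviation "X \<equiv> cochains sH \<Delta>H sC actC sM actM"
abbreviation "d \<equiv> face sC \<Delta>C actC sM \<alpha>"
abbreviation "s \<equiv> degen sC \<epsilon>C sM"
abbreviation "t \<equiv> cyclic_op sC actC sM \<alpha>"
abbreviation "swC \<equiv> sweedler sM \<Delta>C"
abbreviation "swH \<equiv> sweedler sM \<Delta>H"
abbreviation "powH \<equiv> sweedler_power sM \<Delta>H \<epsilon>H"

lemma vector_space_C: "vector_space sC" and vector_space_H: "vector_space sH" and vector_space_M: "vector_space sM"
  by unfold_locales


lemma sweedler_comult_act:
  assumes "\<And>b. Vector_Spaces.linear sC sM (\<lambda>a. \<phi> a b)" "\<And>a. Vector_Spaces.linear sC sM (\<phi> a)"
  shows "swC \<phi> (actC h c) = swH (\<lambda>p q. swC (\<lambda>a b. \<phi> (actC p a) (actC q b)) c) h"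
proof -
  let ?\<Phi> = "\<lambda>xs. \<phi> (xs ! 0) (xs ! 1)"
  have ml: "multilinear sC sM 2 ?\<Phi>" by (rule multilinear_pairI[OF assms])
  have lift: "tensor_lift sM ?\<Phi> (tensor_lift_tensor sC 2 \<psi> u) = tensor_lift sM (\<lambda>xs. tensor_lift sM ?\<Phi> (\<psi> xs)) u"
    if "u \<in> tensor_power s' 2" "\<And>ys. \<psi> ys \<in> tensor_power sC 2" for \<psi> s' and u :: "('k, 'e::ab_group_add) tensor"
    by (rule tensor_lift_lift_tensor[OF vector_space_M ml that])
  show ?thesis
    unfolding sweedler_def C.comult_act
    by (simp add: lift[OF C.H.comult_closed] lift[OF C.C.comult_closed] tensor_lift_tensor_closed(2)[OF C.C.comult_closed]
        pure_closed tensor_lift_pure[OF vector_space_M ml] del: One_nat_def)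
qed

lemma cochain_hom: "f \<in> X n \<Longrightarrow> f \<in> tensor_hom sC (Suc n) sM"
  by (simp add: cochains_def)

lemma cochain_multilinear: "f \<in> X n \<Longrightarrow> multilinear sC sM (Suc n) (\<lambda>cs. f (pure sC cs))"
  by (rule tensor_hom_multilinear[OF cochain_hom vector_space_C vector_space_M])

lemma cochain_eqI:
  assumes "f \<in> X n" "g \<in> X n" "\<And>cs. length cs = Suc n \<Longrightarrow> f (pure sC cs) = g (pure sC cs)"
  shows "f = g"
  by (rule tensor_hom_eqI[OF cochain_hom[OF assms(1)] cochain_hom[OF assms(2)] vector_space_M assms(3)])

text \<open>This eliminates the cosets from the definition of the diagonal action: equivariance becomes an equation
between Sweedler sums in which the factors of \<open>h\<close> are paired with the letters of a word.\<close>

lemma hom_diagonal_act: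
  assumes f: "f \<in> tensor_hom sC (Suc n) sM" and u: "u \<in> tensor_power sC (Suc n)"
  shows "f (diagonal_act sH \<Delta>H sC actC n h u)
       = tensor_lift sM (\<lambda>cs. powH (Suc n) (\<lambda>hs. f (pure sC (map2 actC hs cs))) h) u"
proof -
  let ?g = "\<lambda>cs. f (pure sC cs)"
  have ml: "multilinear sC sM (Suc n) ?g" by (rule tensor_hom_multilinear[OF f vector_space_C vector_space_M])
  define in_h where "in_h cs = tensor_lift_tensor sC (Suc n) (\<lambda>hs. pure sC (map2 actC hs cs)) (iterated_comult sH \<Delta>H n h)" for cs
  have closed: "in_h cs \<in> tensor_power sC (Suc n)" if "length cs = Suc n" for cs
    unfolding in_h_def by (rule tensor_lift_tensor_closed(2)[OF C.H.iterated_comult_closed]) (simp add: pure_closed that)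
  have val: "tensor_lift sM ?g (in_h cs) = powH (Suc n) (\<lambda>hs. ?g (map2 actC hs cs)) h" if len: "length cs = Suc n" for cs
  proof -
    have "tensor_lift sM ?g (in_h cs) = tensor_lift sM (\<lambda>hs. tensor_lift sM ?g (pure sC (map2 actC hs cs))) (iterated_comult sH \<Delta>H n h)"
      unfolding in_h_def
      by (rule tensor_lift_lift_tensor[OF vector_space_M ml C.H.iterated_comult_closed]) (simp add: pure_closed len)
    also have "\<dots> = tensor_lift sM (\<lambda>hs. ?g (map2 actC hs cs)) (iterated_comult sH \<Delta>H n h)"
      by (rule tensor_lift_cong[OF C.H.iterated_comult_closed]) (simp add: tensor_lift_pure[OF vector_space_M ml] len)
    also have "\<dots> = powH (Suc n) (\<lambda>hs. ?g (map2 actC hs cs)) h"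
      by (rule C.H.iterated_comult_lift[OF vector_space_M multilinear_map2[OF ml C.CM.act_linear_left len]])
    finally show ?thesis .
  qed
  have "f (diagonal_act sH \<Delta>H sC actC n h u) = tensor_lift sM ?g (diagonal_act sH \<Delta>H sC actC n h u)"
    unfolding diagonal_act_def Suc_eq_plus1[symmetric] in_h_def[symmetric]
    by (rule tensor_hom_eq_lift[OF f vector_space_M tensor_lift_tensor_closed(2)[OF u closed]])
  also have "\<dots> = tensor_lift sM (\<lambda>cs. tensor_lift sM ?g (in_h cs)) u"
    unfolding diagonal_act_def Suc_eq_plus1[symmetric] in_h_def[symmetric]
    by (rule tensor_lift_lift_tensor[OF vector_space_M ml u closed])
  also have "\<dots> = tensor_lift sM (\<lambda>cs. powH (Suc n) (\<lambda>hs. ?g (map2 actC hs cs)) h) u"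
    by (rule tensor_lift_cong[OF u val])
  finally show ?thesis .
qed

text \<open>By linearity, \<open>H\<close>-linearity need only be tested on pure tensors, where the diagonal action is a
Sweedler sum.\<close>

lemma cochain_iff:
  assumes f: "f \<in> tensor_hom sC (Suc n) sM"
  shows "f \<in> X n \<longleftrightarrow> (\<forall>h cs. length cs = Suc n \<longrightarrow>
    powH (Suc n) (\<lambda>hs. f (pure sC (map2 actC hs cs))) h = actM h (f (pure sC cs)))"
proof -
  let ?g = "\<lambda>cs. f (pure sC cs)"
  have ml: "multilinear sC sM (Suc n) ?g" by (rule tensor_hom_multilinear[OF f vector_space_C vector_space_M])
  have ml': "multilinear sC sM (Suc n) (\<lambda>cs. powH (Suc n) (\<lambda>hs. ?g (map2 actC hs cs)) h)" for h
    by (intro multilinear_sweedler_power vector_space_C vector_space_M multilinear_map2_right[OF ml] C.CM.act_linear_right)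
  have "(\<forall>h. \<forall>u\<in>tensor_power sC (Suc n). f (diagonal_act sH \<Delta>H sC actC n h u) = actM h (f u)) \<longleftrightarrow>
      (\<forall>h cs. length cs = Suc n \<longrightarrow> powH (Suc n) (\<lambda>hs. ?g (map2 actC hs cs)) h = actM h (?g cs))" (is "?L \<longleftrightarrow> ?R")
  proof
    assume L: ?L
    show ?R
    proof (intro allI impI)
      fix h cs assume len: "length (cs :: 'c list) = Suc n"
      show "powH (Suc n) (\<lambda>hs. ?g (map2 actC hs cs)) h = actM h (?g cs)"
        using hom_diagonal_act[OF f pure_closed[OF len], of h] tensor_lift_pure[OF vector_space_M ml' len, of h]
          L pure_closed[OF len, of sC] by simp
    qed
  next
    assume R: ?R
    show ?L
    proof (intro allI ballI)
      fix h u assume u: "u \<in> tensor_power sC (Suc n)"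
      have "f (diagonal_act sH \<Delta>H sC actC n h u) = tensor_lift sM (\<lambda>cs. actM h (?g cs)) u"
        unfolding hom_diagonal_act[OF f u] by (rule tensor_lift_cong[OF u]) (use R in blast)
      also have "\<dots> = actM h (f u)"
        unfolding tensor_hom_eq_lift[OF f vector_space_M u] by (rule tensor_lift_map[OF M.MM.act_linear_right, symmetric])
      finally show "f (diagonal_act sH \<Delta>H sC actC n h u) = actM h (f u)" .
    qed
  qed
  then show ?thesis using f by (simp add: cochains_def)
qed

lemma cochain_equivariant:
  assumes "f \<in> X n" "length cs = Suc n"
  shows "powH (Suc n) (\<lambda>hs. f (pure sC (map2 actC hs cs))) h = actM h (f (pure sC cs))"
  using cochain_iff[OF cochain_hom[OF assms(1)]] assms by blast

lemma tensor_fun_cochain: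
  assumes ml: "multilinear sC sM (Suc n) \<phi>"
    and eq: "\<And>h cs. length cs = Suc n \<Longrightarrow> powH (Suc n) (\<lambda>hs. \<phi> (map2 actC hs cs)) h = actM h (\<phi> cs)"
  shows "tensor_fun sC (Suc n) sM \<phi> \<in> X n"
proof -
  have "powH (Suc n) (\<lambda>hs. tensor_fun sC (Suc n) sM \<phi> (pure sC (map2 actC hs cs))) h
      = actM h (tensor_fun sC (Suc n) sM \<phi> (pure sC cs))" if len: "length cs = Suc n" for h cs
  proof -
    have "powH (Suc n) (\<lambda>hs. tensor_fun sC (Suc n) sM \<phi> (pure sC (map2 actC hs cs))) h
        = powH (Suc n) (\<lambda>hs. \<phi> (map2 actC hs cs)) h"
      by (rule sweedler_power_cong) (simp add: tensor_fun_pure[OF vector_space_M ml] len)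
    then show ?thesis using eq[OF len] by (simp only: tensor_fun_pure[OF vector_space_M ml len])
  qed
  then show ?thesis using cochain_iff[OF tensor_fun_hom[OF vector_space_M ml]] by blast
qed

lemma cochain_linear:
  assumes "f \<in> X n" "Vector_Spaces.linear s1 sC L" "length us + length vs = n"
  shows "Vector_Spaces.linear s1 sM (\<lambda>z. f (pure sC (us @ L z # vs)))"
  by (rule linear_multilinear_comp[OF cochain_multilinear[OF assms(1)] assms(2)]) (use assms(3) in simp)

section \<open>Faces\<close>

lemma inner_face_formula:
  assumes "length us = i" "i \<le> n"
  shows "face_formula sC \<Delta>C actC sM \<alpha> (Suc n) i f (us @ c # vs) = swC (\<lambda>a b. f (pure sC (us @ a # b # vs))) c"
  using assms by (simp add: face_formula_def sweedler_def nth_middle)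

lemma inner_face_multilinear:
  assumes f: "f \<in> X (Suc n)" and i: "i \<le> n"
  shows "multilinear sC sM (Suc n) (face_formula sC \<Delta>C actC sM \<alpha> (Suc n) i f)"
proof (rule multilinear_insertI[of i])
  let ?g = "\<lambda>cs. f (pure sC cs)"
  fix us vs :: "'c list"
  assume len: "length us = i" "length us + length vs + 1 = Suc n"
  have "Vector_Spaces.linear sC sM (swC (\<lambda>a b. ?g (us @ a # b # vs)))"
    by (rule C.C.linear_sweedler_self[OF vector_space_M])
      (use cochain_linear[OF f linear_identity[OF vector_space_C], of us] cochain_linear[OF f linear_identity[OF vector_space_C], of "us @ [_]" vs] len in simp_all)
  then show "Vector_Spaces.linear sC sM (\<lambda>a. face_formula sC \<Delta>C actC sM \<alpha> (Suc n) i f (us @ a # vs))"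
    by (simp add: inner_face_formula[OF len(1) i])
next
  let ?g = "\<lambda>cs. f (pure sC cs)"
  fix c
  have "multilinear sC sM n (\<lambda>xs. ?g (take i xs @ a # b # drop i xs))" for a b
  proof (rule multilinear_cong[OF _ multilinear_fix[OF multilinear_fix[OF cochain_multilinear[OF f]] i]])
    show "i \<le> Suc n" using i by simp
  qed (use i in simp)
  then have "multilinear sC sM n (\<lambda>xs. swC (\<lambda>a b. ?g (take i xs @ a # b # drop i xs)) c)"
    by (intro multilinear_sweedler vector_space_C vector_space_M)
  then show "multilinear sC sM (Suc n - 1) (\<lambda>xs. face_formula sC \<Delta>C actC sM \<alpha> (Suc n) i f (take i xs @ c # drop i xs))"
    using i by (auto simp: face_formula_def sweedler_def nth_append elim: multilinear_cong[rotated])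
qed (use i in simp)

text \<open>Acting on the word and then comultiplying the letter \<open>c\<close> distributes two Sweedler factors over
\<open>\<Delta>\<^sub>C(c)\<close>. By \<open>sweedler_power_split\<close> these and the factors on the other letters are the \<open>n + 2\<close> factors of \<open>h\<close>,
so \<open>H\<close>-linearity of \<open>f\<close> applies.\<close>

lemma inner_face_closed:
  assumes f: "f \<in> X (Suc n)" and i: "i \<le> n"
  shows "d (Suc n) i f \<in> X n"
  unfolding face_def
proof (rule tensor_fun_cochain[OF inner_face_multilinear[OF f i]])
  fix h and cs :: "'c list"
  assume len: "length cs = Suc n"
  let ?g = "\<lambda>cs. f (pure sC cs)" and ?F = "face_formula sC \<Delta>C actC sM \<alpha> (Suc n) i f"
  obtain us c vs where cs: "cs = us @ c # vs" "length us = i"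
    using split_at[of i cs] len i by auto
  define \<Phi> where "\<Phi> ks = swC (\<lambda>a b. ?g (map2 actC ks (us @ a # b # vs))) c" for ks
  have ml: "multilinear sH sM (Suc (Suc n)) (\<lambda>ks. ?g (map2 actC ks (us @ a # b # vs)))" for a b
    by (rule multilinear_map2[OF cochain_multilinear[OF f] C.CM.act_linear_left]) (use len cs in simp)
  have "?F (map2 actC hs cs) = swH (\<lambda>p q. \<Phi> (take i hs @ p # q # drop (Suc i) hs)) (hs ! i)"
    if lh: "length hs = Suc n" for hs
  proof -
    obtain xs k ys where hs: "hs = xs @ k # ys" "length xs = i" using split_at[of i hs] lh i by auto
    have "?F (map2 actC hs cs) = swC (\<lambda>a b. ?g (map2 actC xs us @ a # b # map2 actC ys vs)) (actC k c)"
      using inner_face_formula[of "map2 actC xs us" i n f "actC k c" "map2 actC ys vs"] i hs cs by simp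
    also have "\<dots> = swH (\<lambda>p q. swC (\<lambda>a b. ?g (map2 actC xs us @ actC p a # actC q b # map2 actC ys vs)) c) k"
      by (rule sweedler_comult_act)
       (use cochain_linear[OF f linear_identity[OF vector_space_C], of "map2 actC xs us"]
          cochain_linear[OF f linear_identity[OF vector_space_C], of "map2 actC xs us @ [_]" "map2 actC ys vs"] len lh hs cs in simp_all)
    finally show ?thesis using hs cs by (simp add: \<Phi>_def nth_middle)
  qed
  then have "powH (Suc n) (\<lambda>hs. ?F (map2 actC hs cs)) h
      = powH (Suc n) (\<lambda>hs. swH (\<lambda>p q. \<Phi> (take i hs @ p # q # drop (Suc i) hs)) (hs ! i)) h"
    by (rule sweedler_power_cong)
  also have "\<dots> = powH (Suc (Suc n)) \<Phi> h"
    by (rule C.H.sweedler_power_split[OF vector_space_M]) (use i in \<open>auto simp: \<Phi>_def[abs_def] intro: multilinear_sweedler vector_space_H vector_space_M ml\<close>)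
  also have "\<dots> = swC (\<lambda>a b. actM h (?g (us @ a # b # vs))) c"
    unfolding \<Phi>_def sweedler_power_swap[OF vector_space_M]
    by (rule sweedler_cong) (rule cochain_equivariant[OF f], use len cs in simp)
  also have "\<dots> = actM h (?F cs)"
    unfolding cs(1) inner_face_formula[OF cs(2) i]
    by (rule sweedler_map[OF M.MM.act_linear_right, symmetric])
  finally show "powH (Suc n) (\<lambda>hs. ?F (map2 actC hs cs)) h = actM h (?F cs)" .
qed

lemma inner_face_pure:
  assumes "f \<in> X (Suc n)" "length us = i" "length us + length vs = n"
  shows "d (Suc n) i f (pure sC (us @ c # vs)) = swC (\<lambda>a b. f (pure sC (us @ a # b # vs))) c"
  unfolding face_def using assms
  by (subst tensor_fun_pure[OF vector_space_M inner_face_multilinear]) (simp_all add: inner_face_formula)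

section \<open>Degeneracies\<close>

lemma degen_formula_split:
  assumes "length us = Suc j"
  shows "degen_formula sC \<epsilon>C sM j f (us @ c # vs) = sM (\<epsilon>C c) (f (pure sC (us @ vs)))"
  using assms by (simp add: degen_formula_def nth_middle)

lemma degen_multilinear:
  assumes f: "f \<in> X n" and j: "j \<le> n"
  shows "multilinear sC sM (Suc (Suc n)) (degen_formula sC \<epsilon>C sM j f)"
proof (rule multilinear_insertI[of "Suc j"])
  fix us vs :: "'c list"
  assume "length us = Suc j"
  then show "Vector_Spaces.linear sC sM (\<lambda>a. degen_formula sC \<epsilon>C sM j f (us @ a # vs))"
    by (simp add: degen_formula_split linear_scalar_times[OF C.C.counit_linear vector_space_M])
next
  fix c
  have "multilinear sC sM (Suc n) (\<lambda>xs. degen_formula sC \<epsilon>C sM j f (take (Suc j) xs @ c # drop (Suc j) xs))"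
    by (rule multilinear_cong[OF _ multilinear_scaled[where c = "\<epsilon>C c", OF cochain_multilinear[OF f]]])
     (use j in \<open>simp add: degen_formula_split\<close>)
  then show "multilinear sC sM (Suc (Suc n) - 1) (\<lambda>xs. degen_formula sC \<epsilon>C sM j f (take (Suc j) xs @ c # drop (Suc j) xs))"
    by simp
qed (use j in simp)

text \<open>The Sweedler factor acting on the deleted letter is absorbed by the counit, which leaves the right
number of factors for \<open>H\<close>-linearity of \<open>f\<close>.\<close>

lemma degen_closed:
  assumes f: "f \<in> X n" and j: "j \<le> n"
  shows "s n j f \<in> X (Suc n)"
  unfolding degen_def add_2_eq_Suc'
proof (rule tensor_fun_cochain[OF degen_multilinear[OF f j]])
  fix h and cs :: "'c list"
  assume len: "length cs = Suc (Suc n)"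
  let ?g = "\<lambda>cs. f (pure sC cs)" and ?F = "degen_formula sC \<epsilon>C sM j f"
  obtain us c vs where cs: "cs = us @ c # vs" "length us = Suc j"
    using split_at[of "Suc j" cs] len j by auto
  define \<Phi> where "\<Phi> ks = sM (\<epsilon>C c) (?g (map2 actC ks (us @ vs)))" for ks
  have "?F (map2 actC hs cs) = sM (\<epsilon>H (hs ! Suc j)) (\<Phi> (take (Suc j) hs @ drop (Suc (Suc j)) hs))"
    if lh: "length hs = Suc (Suc n)" for hs
  proof -
    obtain xs k ys where hs: "hs = xs @ k # ys" "length xs = Suc j" using split_at[of "Suc j" hs] lh j by auto
    have "?F (map2 actC hs cs) = sM (\<epsilon>C (actC k c)) (?g (map2 actC xs us @ map2 actC ys vs))"
      using degen_formula_split[of "map2 actC xs us" j f "actC k c" "map2 actC ys vs"] hs cs by simp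
    then show ?thesis using hs cs by (simp add: \<Phi>_def C.counit_act nth_middle)
  qed
  then have "powH (Suc (Suc n)) (\<lambda>hs. ?F (map2 actC hs cs)) h
      = powH (Suc (Suc n)) (\<lambda>hs. sM (\<epsilon>H (hs ! Suc j)) (\<Phi> (take (Suc j) hs @ drop (Suc (Suc j)) hs))) h"
    by (rule sweedler_power_cong)
  also have "\<dots> = powH (Suc n) \<Phi> h"
    unfolding \<Phi>_def using j
    by (intro C.H.sweedler_power_counit[OF vector_space_M] multilinear_scaled multilinear_map2[OF cochain_multilinear[OF f] C.CM.act_linear_left])
      (use len cs in simp_all)
  also have "\<dots> = sM (\<epsilon>C c) (powH (Suc n) (\<lambda>ks. ?g (map2 actC ks (us @ vs))) h)"
    unfolding \<Phi>_def by (rule sweedler_power_map[OF linear_scaled[OF linear_identity[OF vector_space_M]], symmetric])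
  also have "\<dots> = sM (\<epsilon>C c) (actM h (?g (us @ vs)))"
    by (subst cochain_equivariant[OF f]) (use len cs in simp_all)
  also have "\<dots> = actM h (?F cs)"
    unfolding cs(1) degen_formula_split[OF cs(2)] by (rule linear_scale[OF M.MM.act_linear_right, symmetric])
  finally show "powH (Suc (Suc n)) (\<lambda>hs. ?F (map2 actC hs cs)) h = actM h (?F cs)" .
qed

lemma degen_pure:
  assumes "f \<in> X n" "length us = Suc j" "length us + length vs = Suc n"
  shows "s n j f (pure sC (us @ c # vs)) = sM (\<epsilon>C c) (f (pure sC (us @ vs)))"
  unfolding degen_def add_2_eq_Suc' using assms
  by (subst tensor_fun_pure[OF vector_space_M degen_multilinear]) (simp_all add: degen_formula_split)


section \<open>The cyclic operator\<close>

lemma cyclic_formula_Cons: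
  "cyclic_formula sC actC \<alpha> f (c # cs) = \<alpha> (\<lambda>h. f (pure sC (cs @ [actC h c])))"
  by (simp add: cyclic_formula_def)

lemma cochain_linear_last:
  assumes "f \<in> X n" "Vector_Spaces.linear s1 sC L" "length cs = n"
  shows "Vector_Spaces.linear s1 sM (\<lambda>z. f (pure sC (cs @ [L z])))"
  using cochain_linear[OF assms(1,2), of cs "[]"] assms(3) by simp

lemma cyclic_multilinear:
  assumes f: "f \<in> X n"
  shows "multilinear sC sM (Suc n) (cyclic_formula sC actC \<alpha> f)"
proof (rule multilinear_insertI[of 0])
  fix us vs :: "'c list"
  assume len: "length us = 0" "length us + length vs + 1 = Suc n"
  have "Vector_Spaces.linear sC sM (\<lambda>c. \<alpha> (\<lambda>h. f (pure sC (vs @ [actC h c]))))"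
    by (intro M.MC.linear_contra vector_space_C cochain_linear_last[OF f] C.CM.act_linear_left C.CM.act_linear_right)
      (use len in simp_all)
  then show "Vector_Spaces.linear sC sM (\<lambda>a. cyclic_formula sC actC \<alpha> f (us @ a # vs))"
    using len by (simp add: cyclic_formula_Cons)
next
  fix c
  have "multilinear sC sM n (\<lambda>xs. \<alpha> (\<lambda>h. f (pure sC (xs @ [actC h c]))))"
    unfolding multilinear_def
  proof (intro allI impI)
    fix xs ys :: "'c list"
    assume len: "length xs + length ys + 1 = n"
    show "Vector_Spaces.linear sC sM (\<lambda>a. \<alpha> (\<lambda>h. f (pure sC ((xs @ a # ys) @ [actC h c]))))"
    proof (intro M.MC.linear_contra vector_space_C)
      show "Vector_Spaces.linear sH sM (\<lambda>h. f (pure sC ((xs @ a # ys) @ [actC h c])))" for a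
        by (rule cochain_linear_last[OF f C.CM.act_linear_left]) (use len in simp)
      show "Vector_Spaces.linear sC sM (\<lambda>a. f (pure sC ((xs @ a # ys) @ [actC h c])))" for h
        using cochain_linear[OF f linear_identity[OF vector_space_C], of xs "ys @ [actC h c]"] len by simp
    qed
  qed
  then show "multilinear sC sM (Suc n - 1) (\<lambda>xs. cyclic_formula sC actC \<alpha> f (take 0 xs @ c # drop 0 xs))"
    by (simp add: cyclic_formula_Cons)
qed simp

text \<open>Writing the threefold comultiplication as nested sums separates the first factor, which goes inside \<open>f\<close>,
from the other two, which are to cancel against each other.\<close>

lemma ayd_sweedler:
  assumes f: "Vector_Spaces.linear sH sM f"
  shows "actM h (\<alpha> f) = \<alpha> (\<lambda>h'. swH (\<lambda>a y. swH (\<lambda>b e. actM b (f (S e * h' * a))) y) h)"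
proof -
  have "tensor_lift sM (\<lambda>hs. actM (hs ! 1) (f (S (hs ! 2) * h' * hs ! 0))) (iterated_comult sH \<Delta>H 2 h)
      = swH (\<lambda>a y. swH (\<lambda>b e. actM b (f (S e * h' * a))) y) h" for h'
  proof -
    let ?\<Psi> = "\<lambda>hs. actM (hs ! 1) (f (S (hs ! 2) * h' * hs ! 0))"
    have ml: "multilinear sH sM 3 ?\<Psi>"
    proof (rule multilinear_tripleI)
      show "Vector_Spaces.linear sH sM (\<lambda>b. actM b (f (S e * h' * a)))" for a e
        by (rule M.MM.act_linear_left)
      have "Vector_Spaces.linear sH sH (\<lambda>a. S e * h' * a)" "Vector_Spaces.linear sH sH (\<lambda>e. S e * h' * a)" for a e
        by (intro linearI vector_space_H;
            simp add: linear_plus[OF C.H.antipode_linear] linear_scale[OF C.H.antipode_linear]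
              distrib_left distrib_right C.H.scale_mult_left C.H.scale_mult_right)+
      then show "Vector_Spaces.linear sH sM (\<lambda>a. actM b (f (S e * h' * a)))"
        "Vector_Spaces.linear sH sM (\<lambda>e. actM b (f (S e * h' * a)))" for a b e
        using linear_comp[OF M.MM.act_linear_right linear_comp[OF f]] by blast+
    qed
    have "tensor_lift sM ?\<Psi> (iterated_comult sH \<Delta>H 2 h) = powH (Suc 2) ?\<Psi> h"
      by (rule C.H.iterated_comult_lift[OF vector_space_M]) (use ml in \<open>simp add: numeral_3_eq_3 numeral_2_eq_2\<close>)
    also have "\<dots> = swH (\<lambda>a y. powH 2 (\<lambda>xs. ?\<Psi> (a # xs)) y) h"
      by (simp only: sweedler_power.simps)
    also have "\<dots> = swH (\<lambda>a y. swH (\<lambda>b e. actM b (f (S e * h' * a))) y) h"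
    proof (rule sweedler_cong)
      fix a y
      have "multilinear sH sM 2 (\<lambda>xs. ?\<Psi> (a # xs))"
        using multilinear_Cons[of sH sM 2 ?\<Psi> a] ml by (simp add: numeral_3_eq_3 numeral_2_eq_2)
      from C.H.sweedler_power_two[OF vector_space_M this, of y]
      show "powH 2 (\<lambda>xs. ?\<Psi> (a # xs)) y = swH (\<lambda>b e. actM b (f (S e * h' * a))) y"
        by (simp add: numeral_2_eq_2 del: sweedler_power.simps)
    qed
    finally show ?thesis .
  qed
  then show ?thesis by (simp only: M.ayd[OF f])
qed

text \<open>The auxiliary \<open>\<theta> bs k\<close> is \<open>f\<close> on the letters acted on by \<open>bs\<close>, followed by the first letter
acted on by \<open>k\<close>. Both sides of the equivariance condition are brought to the form of \<open>\<alpha>\<close> applied to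
the sum of \<open>\<theta> [h\<^sub>(\<^sub>2\<^sub>), \<dots>] (h' h\<^sub>(\<^sub>1\<^sub>))\<close>. The claim \<open>inner\<close> does this for the side produced by the
anti-Yetter-Drinfeld condition: the element \<open>b\<close> that acts on the value of \<open>f\<close> is distributed over the
letters, and its last factor meets the antipode of the following factor.\<close>

lemma cyclic_closed:
  assumes f: "f \<in> X n"
  shows "t n f \<in> X n"
  unfolding cyclic_op_def Suc_eq_plus1[symmetric]
proof (rule tensor_fun_cochain[OF cyclic_multilinear[OF f]])
  fix h and cs0 :: "'c list"
  assume "length cs0 = Suc n"
  then obtain c cs where cs0: "cs0 = c # cs" and len: "length cs = n" by (auto simp: length_Suc_conv)
  let ?g = "\<lambda>cs. f (pure sC cs)" and ?F = "cyclic_formula sC actC \<alpha> f"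
  define \<theta> where "\<theta> bs k = ?g (map2 actC bs cs @ [actC k c])" for bs k
  have \<theta>: "Vector_Spaces.linear sH sM (\<theta> bs)" if "length bs = n" for bs
    unfolding \<theta>_def by (rule cochain_linear_last[OF f C.CM.act_linear_left]) (use that len in simp)
  have right_mult: "Vector_Spaces.linear sH sH (\<lambda>k. k * b)" and left_mult: "Vector_Spaces.linear sH sH (\<lambda>k. b * k)" for b
    by (intro linearI vector_space_H; simp add: distrib_left distrib_right C.H.scale_mult_left C.H.scale_mult_right)+
  have inner: "swH (\<lambda>b e. actM b (?g (cs @ [actC (S e * k) c]))) y = powH n (\<lambda>bs. \<theta> bs k) y" for k y
  proof -
    \<comment> \<open>The first \<open>n\<close> entries act on \<open>cs\<close>; the next acts on \<open>c\<close> after the antipode of the last.\<close>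
    define \<Xi> where "\<Xi> ks = \<theta> (take n ks) (ks ! n * (S (ks ! Suc n) * k))" for ks
    have ml: "multilinear sH sM (Suc (Suc n)) \<Xi>"
    proof (rule multilinear_insertI[of "Suc n"])
      fix us vs :: "'h list"
      assume lu: "length us = Suc n" "length us + length vs + 1 = Suc (Suc n)"
      have "Vector_Spaces.linear sH sM (\<lambda>e. \<theta> (take n us) (us ! n * (S e * k)))"
        by (intro linear_comp[OF \<theta>] linear_comp[OF left_mult] linear_comp[OF right_mult] C.H.antipode_linear)
          (use lu in simp)
      then show "Vector_Spaces.linear sH sM (\<lambda>e. \<Xi> (us @ e # vs))"
        using lu by (simp add: \<Xi>_def nth_append)
    next
      fix e
      show "multilinear sH sM (Suc (Suc n) - 1) (\<lambda>xs. \<Xi> (take (Suc n) xs @ e # drop (Suc n) xs))"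
        unfolding diff_Suc_1
      proof (rule multilinear_cong[OF _ multilinear_map2[OF cochain_multilinear[OF f] C.CM.act_linear_left]])
        show "length (cs @ [actC (S e * k) c]) = Suc n" using len by simp
        fix xs :: "'h list"
        assume "length xs = Suc n"
        then obtain bs b where xs: "xs = bs @ [b]" "length bs = n" by (auto simp: length_Suc_conv_rev)
        then show "\<Xi> (take (Suc n) xs @ e # drop (Suc n) xs) = ?g (map2 actC xs (cs @ [actC (S e * k) c]))"
          using len by (simp add: \<Xi>_def \<theta>_def nth_append C.CM.act_mult)
      qed
    qed simp
    have "swH (\<lambda>b e. actM b (?g (cs @ [actC (S e * k) c]))) y = swH (\<lambda>b e. powH (Suc n) (\<lambda>bs. \<Xi> (bs @ [e])) b) y"
    proof (rule sweedler_cong)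
      fix b e
      have "actM b (?g (cs @ [actC (S e * k) c])) = powH (Suc n) (\<lambda>bs. ?g (map2 actC bs (cs @ [actC (S e * k) c]))) b"
        by (rule cochain_equivariant[OF f, symmetric]) (use len in simp)
      also have "\<dots> = powH (Suc n) (\<lambda>bs. \<Xi> (bs @ [e])) b"
      proof (rule sweedler_power_cong)
        fix xs :: "'h list"
        assume "length xs = Suc n"
        then obtain bs b where xs: "xs = bs @ [b]" "length bs = n" by (auto simp: length_Suc_conv_rev)
        then show "?g (map2 actC xs (cs @ [actC (S e * k) c])) = \<Xi> (xs @ [e])"
          using len by (simp add: \<Xi>_def \<theta>_def nth_append C.CM.act_mult)
      qed
      finally show "actM b (?g (cs @ [actC (S e * k) c])) = powH (Suc n) (\<lambda>bs. \<Xi> (bs @ [e])) b" .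
    qed
    also have "\<dots> = powH (Suc (Suc n)) \<Xi> y"
      by (rule C.H.sweedler_power_snoc[OF vector_space_M ml])
    also have "\<dots> = powH n (\<lambda>bs. \<theta> bs (1 * k)) y"
      unfolding \<Xi>_def mult.assoc[symmetric]
      by (rule C.H.sweedler_power_antipode[OF vector_space_M, of n "\<lambda>bs z. \<theta> bs (z * k)"]) (rule linear_comp[OF \<theta> right_mult])
    finally show ?thesis by simp
  qed
  have "powH (Suc n) (\<lambda>hs. ?F (map2 actC hs cs0)) h = powH (Suc n) (\<lambda>hs. \<alpha> (\<lambda>h'. \<theta> (tl hs) (h' * hd hs))) h"
  proof (rule sweedler_power_cong)
    fix hs :: "'h list"
    assume "length hs = Suc n"
    then obtain k ks where "hs = k # ks" by (auto simp: length_Suc_conv)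
    then show "?F (map2 actC hs cs0) = \<alpha> (\<lambda>h'. \<theta> (tl hs) (h' * hd hs))"
      by (simp add: cs0 cyclic_formula_Cons \<theta>_def C.CM.act_mult)
  qed
  also have "\<dots> = \<alpha> (\<lambda>h'. powH (Suc n) (\<lambda>hs. \<theta> (tl hs) (h' * hd hs)) h)"
    by (rule M.MC.contra_sweedler_power[symmetric]) (intro linear_comp[OF \<theta> right_mult], simp)
  also have "\<dots> = \<alpha> (\<lambda>h'. swH (\<lambda>a y. powH n (\<lambda>bs. \<theta> bs (h' * a)) y) h)"
    by simp
  also have "\<dots> = \<alpha> (\<lambda>h'. swH (\<lambda>a y. swH (\<lambda>b e. actM b (?g (cs @ [actC (S e * h' * a) c]))) y) h)"
    by (simp only: inner mult.assoc)
  also have "\<dots> = actM h (\<alpha> (\<lambda>h'. ?g (cs @ [actC h' c])))"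
    by (rule ayd_sweedler[symmetric]) (rule cochain_linear_last[OF f C.CM.act_linear_left len])
  also have "\<dots> = actM h (?F cs0)" by (simp add: cs0 cyclic_formula_Cons)
  finally show "powH (Suc n) (\<lambda>hs. ?F (map2 actC hs cs0)) h = actM h (?F cs0)" .
qed

lemma cyclic_pure:
  assumes "f \<in> X n" "length cs = n"
  shows "t n f (pure sC (c # cs)) = \<alpha> (\<lambda>h. f (pure sC (cs @ [actC h c])))"
  unfolding cyclic_op_def Suc_eq_plus1[symmetric] using assms(2)
  by (subst tensor_fun_pure[OF vector_space_M cyclic_multilinear[OF assms(1)]]) (simp_all add: cyclic_formula_Cons)

lemma cyclic_iterate_closed: "f \<in> X n \<Longrightarrow> (t n ^^ j) f \<in> X n"
  by (induction j) (simp_all add: cyclic_closed)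

text \<open>Each further application of \<open>t\<close> adds an outer \<open>\<alpha>\<close> whose free argument acts on the first letter;
contraassociativity makes it the first Sweedler factor of a common free argument.\<close>

lemma cyclic_iterate_pure:
  assumes f: "f \<in> X n"
  shows "length us = j \<Longrightarrow> length us + length vs = Suc n \<Longrightarrow>
    (t n ^^ j) f (pure sC (us @ vs)) = \<alpha> (powH j (\<lambda>hs. f (pure sC (vs @ map2 actC hs us))))"
proof (induction j arbitrary: us vs)
  case 0
  then show ?case by (simp add: M.MC.contra_unit)
next
  case (Suc j)
  then obtain c ws where us: "us = c # ws" "length ws = j" by (auto simp: length_Suc_conv)
  have len: "length (ws @ vs) = n" using Suc.prems us by simp
  let ?\<phi> = "\<lambda>x. powH j (\<lambda>hs. f (pure sC (vs @ actC x c # map2 actC hs ws)))"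
  have "(t n ^^ Suc j) f (pure sC (us @ vs)) = \<alpha> (\<lambda>x. (t n ^^ j) f (pure sC (ws @ (vs @ [actC x c]))))"
    using cyclic_pure[OF cyclic_iterate_closed[OF f] len, of j c] us by simp
  also have "\<dots> = \<alpha> (\<lambda>x. \<alpha> (?\<phi> x))"
    by (subst Suc.IH) (use us Suc.prems in simp_all)
  also have "\<dots> = \<alpha> (swH ?\<phi>)"
  proof (rule M.MC.contra_assoc_sweedler)
    show "Vector_Spaces.linear sH sM (\<lambda>x. ?\<phi> x y)" for y
      by (intro linear_sweedler_power vector_space_H vector_space_M cochain_linear[OF f] C.CM.act_linear_left) (use us Suc.prems in simp)
    have "multilinear sC sM j (\<lambda>cs. f (pure sC (vs @ actC x c # cs)))" for x
    proof -
      have "Suc n = length (vs @ [actC x c]) + j + length []" using us Suc.prems by simp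
      then show ?thesis
        using multilinear_append[of sC sM "vs @ [actC x c]" j "[]" "\<lambda>cs. f (pure sC cs)"] cochain_multilinear[OF f] by simp
    qed
    then show "Vector_Spaces.linear sH sM (?\<phi> x)" for x
      by (intro C.H.linear_sweedler_power_self vector_space_M multilinear_map2[OF _ C.CM.act_linear_left] us)
  qed
  also have "swH ?\<phi> = powH (Suc j) (\<lambda>hs. f (pure sC (vs @ map2 actC hs us)))"
    by (rule ext) (simp add: us)
  finally show ?case .
qed

lemma cyclic_twice_pure:
  assumes f: "f \<in> X (Suc n)" and len: "length cs = n"
  shows "t (Suc n) (t (Suc n) f) (pure sC (b # c # cs))
       = \<alpha> (swH (\<lambda>h k. f (pure sC (cs @ [actC h b, actC k c]))))"
proof -
  have "multilinear sC sM 2 (\<lambda>xs. f (pure sC (cs @ xs)))"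
    using multilinear_append[of sC sM cs 2 "[]"] cochain_multilinear[OF f] len by (simp add: numeral_2_eq_2)
  then have ml: "multilinear sH sM 2 (\<lambda>hs. f (pure sC (cs @ map2 actC hs [b, c])))"
    by (rule multilinear_map2[OF _ C.CM.act_linear_left]) simp
  have "powH 2 (\<lambda>hs. f (pure sC (cs @ map2 actC hs [b, c]))) = swH (\<lambda>h k. f (pure sC (cs @ [actC h b, actC k c])))"
    using C.H.sweedler_power_two[OF vector_space_M ml] by (intro ext) simp
  then show ?thesis
    using cyclic_iterate_pure[OF f, of "[b, c]" 2 cs] len by (simp add: numeral_2_eq_2 del: sweedler_power.simps)
qed

text \<open>After \<open>n + 1\<close> steps all letters are back in place, each acted on by its Sweedler factor of the free
argument \<open>h\<close>. By \<open>H\<close>-linearity the integrand is \<open>h\<close> acting on the value of \<open>f\<close>, and stability removes it.\<close>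

lemma cyclic_power_id:
  assumes f: "f \<in> X n"
  shows "(t n ^^ Suc n) f = f"
proof (rule cochain_eqI[OF cyclic_iterate_closed[OF f] f])
  fix cs :: "'c list"
  assume len: "length cs = Suc n"
  have "(t n ^^ Suc n) f (pure sC cs) = \<alpha> (\<lambda>h. powH (Suc n) (\<lambda>hs. f (pure sC (map2 actC hs cs))) h)"
    using cyclic_iterate_pure[OF f, of cs "Suc n" "[]"] len by simp
  also have "\<dots> = f (pure sC cs)"
    by (simp only: cochain_equivariant[OF f len] M.stable)
  finally show "(t n ^^ Suc n) f (pure sC cs) = f (pure sC cs)" .
qed

text \<open>The last face is the face \<open>0\<close> after the cyclic operator: the only difference between the two
expressions is the order of \<open>\<alpha>\<close> and the Sweedler sum.\<close>

lemma last_face_formula_eq: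
  assumes f: "f \<in> X (Suc n)" and "length cs0 = Suc n"
  shows "face_formula sC \<Delta>C actC sM \<alpha> (Suc n) (Suc n) f cs0
       = face_formula sC \<Delta>C actC sM \<alpha> (Suc n) 0 (t (Suc n) f) cs0"
proof -
  from assms(2) obtain c cs where cs0: "cs0 = c # cs" and len: "length cs = n" by (auto simp: length_Suc_conv)
  have "face_formula sC \<Delta>C actC sM \<alpha> (Suc n) (Suc n) f cs0
      = \<alpha> (\<lambda>h. swC (\<lambda>a b. f (pure sC ((b # cs) @ [actC h a]))) c)"
    by (simp add: face_formula_def sweedler_def cs0)
  also have "\<dots> = swC (\<lambda>a b. \<alpha> (\<lambda>h. f (pure sC ((b # cs) @ [actC h a])))) c"
    by (intro M.MC.contra_sweedler cochain_linear_last[OF f] C.CM.act_linear_left) (use len in simp)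
  also have "\<dots> = swC (\<lambda>a b. t (Suc n) f (pure sC (a # b # cs))) c"
    by (rule sweedler_cong, subst cyclic_pure[OF f]) (use len in simp_all)
  also have "\<dots> = face_formula sC \<Delta>C actC sM \<alpha> (Suc n) 0 (t (Suc n) f) cs0"
    using inner_face_formula[of "[]" 0 n "t (Suc n) f" c cs] by (simp add: cs0)
  finally show ?thesis .
qed

lemma last_face_eq:
  assumes f: "f \<in> X (Suc n)"
  shows "d (Suc n) (Suc n) f = d (Suc n) 0 (t (Suc n) f)"
  unfolding face_def by (rule tensor_fun_cong) (rule last_face_formula_eq[OF f])

lemma face_multilinear:
  assumes "f \<in> X (Suc n)" "i \<le> Suc n"
  shows "multilinear sC sM (Suc n) (face_formula sC \<Delta>C actC sM \<alpha> (Suc n) i f)"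
proof (cases "i = Suc n")
  case True
  show ?thesis
    unfolding True
    by (rule multilinear_cong[OF last_face_formula_eq[OF assms(1)] inner_face_multilinear[OF cyclic_closed[OF assms(1)]]])
      simp_all
qed (use assms inner_face_multilinear in simp)

lemma face_closed:
  assumes "f \<in> X (Suc n)" "i \<le> Suc n"
  shows "d (Suc n) i f \<in> X n"
proof (cases "i = Suc n")
  case True
  then show ?thesis by (simp add: last_face_eq assms(1) inner_face_closed cyclic_closed)
qed (use assms inner_face_closed in simp)

section \<open>Linear structure\<close>

lemma cochain_add:
  assumes f: "f \<in> X n" and g: "g \<in> X n"
  shows "f + g \<in> X n"
proof -
  have "f + g \<in> tensor_hom sC (Suc n) sM"
    using cochain_hom[OF f] cochain_hom[OF g] by (simp add: tensor_hom_def M.MM.V.scale_right_distrib)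
  then show ?thesis
    using cochain_iff cochain_equivariant[OF f] cochain_equivariant[OF g]
    by (simp add: sweedler_power_add[OF vector_space_M] linear_plus[OF M.MM.act_linear_right] del: sweedler_power.simps)
qed

lemma cochain_scale:
  assumes f: "f \<in> X n"
  shows "pointwise_scale sM c f \<in> X n"
proof -
  have "pointwise_scale sM c f \<in> tensor_hom sC (Suc n) sM"
    using cochain_hom[OF f] by (simp add: tensor_hom_def M.MM.V.scale_right_distrib pointwise_scale_def mult.commute)
  moreover have "powH (Suc n) (\<lambda>hs. sM c (f (pure sC (map2 actC hs cs)))) h = sM c (actM h (f (pure sC cs)))"
    if "length cs = Suc n" for h cs
    by (simp only: cochain_equivariant[OF f that] sweedler_power_map[OF linear_scaled[OF linear_identity[OF vector_space_M]], symmetric])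
  ultimately show ?thesis
    by (simp add: cochain_iff pointwise_scale_def linear_scale[OF M.MM.act_linear_right] del: sweedler_power.simps)
qed

lemma cochain_zero: "0 \<in> X n"
proof -
  have "(0 :: ('k, 'c) tensor \<Rightarrow> 'm) \<in> tensor_hom sC (Suc n) sM"
    by (simp add: tensor_hom_def)
  moreover have "powH (Suc n) (\<lambda>hs. 0) h = 0" for h
    using sweedler_power_add[OF vector_space_M, of \<Delta>H \<epsilon>H "Suc n" "\<lambda>hs. 0" "\<lambda>hs. 0" h] by simp
  moreover have "actM h 0 = 0" for h
    using linear_plus[OF M.MM.act_linear_right, of h 0 0] by simp
  ultimately show ?thesis by (simp add: cochain_iff del: sweedler_power.simps)
qed

lemma pointwise_scale_apply: "pointwise_scale sM c f u = sM c (f u)"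
  by (simp add: pointwise_scale_def)

lemma vector_space_pointwise: "vector_space (pointwise_scale sM)"
  by unfold_locales
    (auto simp: pointwise_scale_def fun_eq_iff M.MM.V.scale_right_distrib M.MM.V.scale_left_distrib)

lemma cyclic_plus:
  assumes f: "f \<in> X n" and g: "g \<in> X n"
  shows "t n (f + g) = t n f + t n g"
proof (rule cochain_eqI[OF cyclic_closed[OF cochain_add[OF f g]] cochain_add[OF cyclic_closed[OF f] cyclic_closed[OF g]]])
  fix cs0 :: "'c list"
  assume "length cs0 = Suc n"
  then obtain c cs where cs0: "cs0 = c # cs" and len: "length cs = n" by (auto simp: length_Suc_conv)
  show "t n (f + g) (pure sC cs0) = (t n f + t n g) (pure sC cs0)"
    using M.MC.contra_add[OF cochain_linear_last[OF f C.CM.act_linear_left len] cochain_linear_last[OF g C.CM.act_linear_left len]]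
    by (simp add: cs0 cyclic_pure[OF _ len] cochain_add f g)
qed

lemma cyclic_scale:
  assumes f: "f \<in> X n"
  shows "t n (pointwise_scale sM c f) = pointwise_scale sM c (t n f)"
proof (rule cochain_eqI[OF cyclic_closed[OF cochain_scale[OF f]] cochain_scale[OF cyclic_closed[OF f]]])
  fix cs0 :: "'c list"
  assume "length cs0 = Suc n"
  then obtain x cs where cs0: "cs0 = x # cs" and len: "length cs = n" by (auto simp: length_Suc_conv)
  show "t n (pointwise_scale sM c f) (pure sC cs0) = pointwise_scale sM c (t n f) (pure sC cs0)"
    using M.MC.contra_scale[OF cochain_linear_last[OF f C.CM.act_linear_left len]]
      cyclic_pure[OF cochain_scale[OF f] len] cyclic_pure[OF f len]
    by (simp add: cs0 pointwise_scale_def)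
qed

text \<open>Cochains are compared on words split at the position where the operators act.\<close>

lemma cochain_eq_splitI:
  assumes "f \<in> X n" "g \<in> X n" "i \<le> n"
    and "\<And>us c vs. length us = i \<Longrightarrow> length us + length vs = n \<Longrightarrow> f (pure sC (us @ c # vs)) = g (pure sC (us @ c # vs))"
  shows "f = g"
proof (rule cochain_eqI[OF assms(1,2)])
  fix cs :: "'c list"
  assume len: "length cs = Suc n"
  then obtain us c vs where "cs = us @ c # vs" "length us = i" using split_at[of i cs] assms(3) by auto
  then show "f (pure sC cs) = g (pure sC cs)" using assms(4)[of us vs c] len by simp
qed

lemma inner_face_plus:
  assumes f: "f \<in> X (Suc n)" and g: "g \<in> X (Suc n)" and i: "i \<le> n"
  shows "d (Suc n) i (f + g) = d (Suc n) i f + d (Suc n) i g"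
  by (rule cochain_eq_splitI[OF inner_face_closed[OF cochain_add[OF f g] i]
        cochain_add[OF inner_face_closed[OF f i] inner_face_closed[OF g i]] i])
    (simp add: inner_face_pure f g cochain_add sweedler_add[OF vector_space_M])

lemma inner_face_scale:
  assumes f: "f \<in> X (Suc n)" and i: "i \<le> n"
  shows "d (Suc n) i (pointwise_scale sM c f) = pointwise_scale sM c (d (Suc n) i f)"
  by (rule cochain_eq_splitI[OF inner_face_closed[OF cochain_scale[OF f] i]
        cochain_scale[OF inner_face_closed[OF f i]] i])
    (simp add: inner_face_pure[OF cochain_scale[OF f]] inner_face_pure[OF f] pointwise_scale_apply sweedler_scaled[OF vector_space_M])

lemma face_plus:
  assumes "f \<in> X (Suc n)" "g \<in> X (Suc n)" "i \<le> Suc n"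
  shows "d (Suc n) i (f + g) = d (Suc n) i f + d (Suc n) i g"
  using assms
  by (cases "i = Suc n") (simp_all add: last_face_eq cochain_add inner_face_plus cyclic_plus cyclic_closed)

lemma face_scale:
  assumes "f \<in> X (Suc n)" "i \<le> Suc n"
  shows "d (Suc n) i (pointwise_scale sM c f) = pointwise_scale sM c (d (Suc n) i f)"
  using assms
  by (cases "i = Suc n") (simp_all add: last_face_eq cochain_scale inner_face_scale cyclic_scale cyclic_closed)

lemma degen_plus:
  assumes f: "f \<in> X n" and g: "g \<in> X n" and j: "j \<le> n"
  shows "s n j (f + g) = s n j f + s n j g"
  by (rule cochain_eq_splitI[where i = "Suc j", OF degen_closed[OF cochain_add[OF f g] j]
        cochain_add[OF degen_closed[OF f j] degen_closed[OF g j]]])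
    (simp_all add: degen_pure f g j cochain_add M.MM.V.scale_right_distrib)

lemma degen_scale:
  assumes f: "f \<in> X n" and j: "j \<le> n"
  shows "s n j (pointwise_scale sM c f) = pointwise_scale sM c (s n j f)"
  by (rule cochain_eq_splitI[where i = "Suc j", OF degen_closed[OF cochain_scale[OF f] j]
        cochain_scale[OF degen_closed[OF f j]]])
    (simp_all add: degen_pure[OF cochain_scale[OF f]] degen_pure[OF f] j pointwise_scale_apply mult.commute)

section \<open>Identities away from the last face\<close>

text \<open>Adjacent positions need coassociativity; for distant ones the two Sweedler sums are independent.\<close>

lemma inner_face_face:
  assumes f: "f \<in> X (Suc (Suc n))" and ij: "i < j" "j \<le> Suc n"
  shows "d (Suc n) i (d (Suc (Suc n)) j f) = d (Suc n) (j - 1) (d (Suc (Suc n)) i f)"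
proof -
  have i: "i \<le> n" "i \<le> Suc n" using ij by simp_all
  note dj = inner_face_closed[OF f ij(2)] and di = inner_face_closed[OF f i(2)]
  show ?thesis
  proof (rule cochain_eq_splitI[OF inner_face_closed[OF dj i(1)] inner_face_closed[OF di] i(1)])
    show "j - 1 \<le> n" using ij by simp
    fix us vs :: "'c list" and c
    assume us: "length us = i" "length us + length vs = n"
    show "d (Suc n) i (d (Suc (Suc n)) j f) (pure sC (us @ c # vs))
        = d (Suc n) (j - 1) (d (Suc (Suc n)) i f) (pure sC (us @ c # vs))"
    proof (cases "j = Suc i")
      case True
      let ?\<phi> = "\<lambda>x y z. f (pure sC (us @ x # y # z # vs))"
      have lin: "Vector_Spaces.linear sC sM (\<lambda>x. ?\<phi> x y z)" "Vector_Spaces.linear sC sM (\<lambda>y. ?\<phi> x y z)"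
          "Vector_Spaces.linear sC sM (?\<phi> x y)" for x y z
        using cochain_linear[OF f linear_identity[OF vector_space_C], of us]
          cochain_linear[OF f linear_identity[OF vector_space_C], of "us @ [x]"]
          cochain_linear[OF f linear_identity[OF vector_space_C], of "us @ [x, y]"] us by simp_all
      have "d (Suc n) i (d (Suc (Suc n)) j f) (pure sC (us @ c # vs)) = swC (\<lambda>x w. swC (?\<phi> x) w) c"
        using inner_face_pure[OF dj us] inner_face_pure[OF f, of "us @ [_]" j vs] us True by simp
      also have "\<dots> = swC (\<lambda>w z. swC (\<lambda>x y. ?\<phi> x y z) w) c"
        by (rule C.C.sweedler_coassoc[OF vector_space_M lin, symmetric])
      also have "\<dots> = d (Suc n) (j - 1) (d (Suc (Suc n)) i f) (pure sC (us @ c # vs))"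
        using inner_face_pure[OF di us] inner_face_pure[OF f us(1)] us True by simp
      finally show ?thesis .
    next
      case False
      then have "j - Suc (Suc i) < length vs" using ij us by simp
      then obtain ws e zs where vs: "vs = ws @ e # zs" and ws: "length ws = j - Suc (Suc i)"
        using split_at by blast
      have j: "j = Suc (Suc i) + length ws" using ws ij False by simp
      have "d (Suc n) i (d (Suc (Suc n)) j f) (pure sC (us @ c # vs))
          = swC (\<lambda>x y. swC (\<lambda>p q. f (pure sC (us @ x # y # ws @ p # q # zs))) e) c"
        using inner_face_pure[OF dj us] inner_face_pure[OF f, of "us @ [_, _] @ ws" j zs e] us j vs by simp
      also have "\<dots> = swC (\<lambda>p q. swC (\<lambda>x y. f (pure sC (us @ x # y # ws @ p # q # zs))) c) e"
        by (rule sweedler_swap[OF vector_space_M])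
      also have "\<dots> = d (Suc n) (j - 1) (d (Suc (Suc n)) i f) (pure sC ((us @ c # ws) @ e # zs))"
        by (subst inner_face_pure[OF di]) (use inner_face_pure[OF f us(1)] us j vs in simp_all)
      finally show ?thesis by (simp add: vs)
    qed
  qed
qed

lemma degen_degen_eq:
  assumes f: "f \<in> X n" and ij: "i \<le> j" "j \<le> n"
  shows "s (Suc n) i (s n j f) = s (Suc n) (Suc j) (s n i f)"
proof -
  have i: "i \<le> n" using ij by simp
  note sj = degen_closed[OF f ij(2)] and si = degen_closed[OF f i]
  show ?thesis
  proof (rule cochain_eq_splitI[where i = "Suc i", OF degen_closed[OF sj] degen_closed[OF si]])
    fix us vs :: "'c list" and c
    assume us: "length us = Suc i" "length us + length vs = Suc (Suc n)"
    then have "j - i < length vs" using ij by simp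
    then obtain ws e zs where vs: "vs = ws @ e # zs" and ws: "length ws = j - i"
      using split_at by blast
    have j: "j = i + length ws" using ws ij by simp
    have "s (Suc n) i (s n j f) (pure sC (us @ c # vs)) = sM (\<epsilon>C c) (sM (\<epsilon>C e) (f (pure sC (us @ ws @ zs))))"
      using degen_pure[OF sj us(1)] degen_pure[OF f, of "us @ ws" j zs e] us j vs by simp
    also have "\<dots> = sM (\<epsilon>C e) (sM (\<epsilon>C c) (f (pure sC (us @ ws @ zs))))"
      by (simp add: mult.commute)
    also have "\<dots> = s (Suc n) (Suc j) (s n i f) (pure sC ((us @ c # ws) @ e # zs))"
      by (subst degen_pure[OF si]) (use degen_pure[OF f us(1)] us j vs in simp_all)
    finally show "s (Suc n) i (s n j f) (pure sC (us @ c # vs)) = s (Suc n) (Suc j) (s n i f) (pure sC (us @ c # vs))"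
      by (simp add: vs)
  qed (use ij in simp_all)
qed

lemma face_degen_less_eq:
  assumes f: "f \<in> X (Suc n)" and ij: "i < j" "j \<le> Suc n"
  shows "d (Suc (Suc n)) i (s (Suc n) j f) = s n (j - 1) (d (Suc n) i f)"
proof -
  have i: "i \<le> n" "i \<le> Suc n" using ij by simp_all
  note sj = degen_closed[OF f ij(2)] and di = inner_face_closed[OF f i(1)]
  show ?thesis
  proof (rule cochain_eq_splitI[OF inner_face_closed[OF sj i(2)] degen_closed[OF di] i(2)])
    show "j - 1 \<le> n" using ij by simp
    fix us vs :: "'c list" and c
    assume us: "length us = i" "length us + length vs = Suc n"
    then have "j - Suc i < length vs" using ij by simp
    then obtain ws e zs where vs: "vs = ws @ e # zs" and ws: "length ws = j - Suc i"
      using split_at by blast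
    have j: "j = Suc i + length ws" using ws ij by simp
    have "d (Suc (Suc n)) i (s (Suc n) j f) (pure sC (us @ c # vs))
        = swC (\<lambda>x y. sM (\<epsilon>C e) (f (pure sC (us @ x # y # ws @ zs)))) c"
      using inner_face_pure[OF sj us] degen_pure[OF f, of "us @ [_, _] @ ws" j zs e] us j vs by simp
    also have "\<dots> = sM (\<epsilon>C e) (swC (\<lambda>x y. f (pure sC (us @ x # y # ws @ zs))) c)"
      by (rule sweedler_scaled[OF vector_space_M])
    also have "\<dots> = s n (j - 1) (d (Suc n) i f) (pure sC ((us @ c # ws) @ e # zs))"
      by (subst degen_pure[OF di]) (use inner_face_pure[OF f us(1)] us j vs in simp_all)
    finally show "d (Suc (Suc n)) i (s (Suc n) j f) (pure sC (us @ c # vs)) = s n (j - 1) (d (Suc n) i f) (pure sC (us @ c # vs))"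
      by (simp add: vs)
  qed
qed

lemma inner_face_degen_greater_eq:
  assumes f: "f \<in> X (Suc n)" and ij: "Suc j < i" "i \<le> Suc n"
  shows "d (Suc (Suc n)) i (s (Suc n) j f) = s n j (d (Suc n) (i - 1) f)"
proof -
  have j: "j \<le> Suc n" "j \<le> n" "i - 1 \<le> n" using ij by simp_all
  note sj = degen_closed[OF f j(1)] and di = inner_face_closed[OF f j(3)]
  show ?thesis
  proof (rule cochain_eq_splitI[where i = "Suc j", OF inner_face_closed[OF sj ij(2)] degen_closed[OF di j(2)]])
    fix us vs :: "'c list" and c
    assume us: "length us = Suc j" "length us + length vs = Suc n"
    then have "i - Suc (Suc j) < length vs" using ij by simp
    then obtain ws e zs where vs: "vs = ws @ e # zs" and ws: "length ws = i - Suc (Suc j)"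
      using split_at by blast
    have i: "i = Suc (Suc j) + length ws" using ws ij by simp
    have "d (Suc (Suc n)) i (s (Suc n) j f) (pure sC ((us @ c # ws) @ e # zs))
        = swC (\<lambda>x y. sM (\<epsilon>C c) (f (pure sC (us @ ws @ x # y # zs)))) e"
      by (subst inner_face_pure[OF sj]) (use degen_pure[OF f us(1)] us i vs in simp_all)
    also have "\<dots> = sM (\<epsilon>C c) (swC (\<lambda>x y. f (pure sC (us @ ws @ x # y # zs))) e)"
      by (rule sweedler_scaled[OF vector_space_M])
    also have "\<dots> = s n j (d (Suc n) (i - 1) f) (pure sC (us @ c # vs))"
      using degen_pure[OF di us(1)] inner_face_pure[OF f, of "us @ ws" "i - 1" zs e] us i vs by simp
    finally show "d (Suc (Suc n)) i (s (Suc n) j f) (pure sC (us @ c # vs)) = s n j (d (Suc n) (i - 1) f) (pure sC (us @ c # vs))"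
      by (simp add: vs)
  qed (use ij in simp_all)
qed

lemma face_degen_same_eq:
  assumes f: "f \<in> X n" and j: "j \<le> n"
  shows "d (Suc n) j (s n j f) = f"
proof (rule cochain_eq_splitI[OF inner_face_closed[OF degen_closed[OF f j] j] f j])
  fix us vs :: "'c list" and c
  assume us: "length us = j" "length us + length vs = n"
  have "d (Suc n) j (s n j f) (pure sC (us @ c # vs)) = swC (\<lambda>x y. sM (\<epsilon>C y) (f (pure sC (us @ x # vs)))) c"
    using inner_face_pure[OF degen_closed[OF f j] us] degen_pure[OF f, of "us @ [_]" j vs] us by simp
  also have "\<dots> = f (pure sC (us @ c # vs))"
    by (rule C.C.sweedler_counit_right[OF cochain_linear[OF f linear_identity[OF vector_space_C] us(2)]])
  finally show "d (Suc n) j (s n j f) (pure sC (us @ c # vs)) = f (pure sC (us @ c # vs))" .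
qed

lemma inner_face_degen_succ_eq:
  assumes f: "f \<in> X n" and j: "Suc j \<le> n"
  shows "d (Suc n) (Suc j) (s n j f) = f"
proof -
  have j': "j \<le> n" using j by simp
  show ?thesis
  proof (rule cochain_eq_splitI[OF inner_face_closed[OF degen_closed[OF f j'] j] f j])
    fix us vs :: "'c list" and c
    assume us: "length us = Suc j" "length us + length vs = n"
    have "d (Suc n) (Suc j) (s n j f) (pure sC (us @ c # vs)) = swC (\<lambda>x y. sM (\<epsilon>C x) (f (pure sC (us @ y # vs)))) c"
      using inner_face_pure[OF degen_closed[OF f j'] us] degen_pure[OF f us(1)] us by simp
    also have "\<dots> = f (pure sC (us @ c # vs))"
      by (rule C.C.sweedler_counit_left[OF cochain_linear[OF f linear_identity[OF vector_space_C] us(2)]])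
    finally show "d (Suc n) (Suc j) (s n j f) (pure sC (us @ c # vs)) = f (pure sC (us @ c # vs))" .
  qed
qed

text \<open>The operator \<open>t\<close> moves the first letter to the end, so an inner face commutes with it up to a shift of
the position.\<close>

lemma inner_face_cyclic:
  assumes f: "f \<in> X (Suc n)" and i: "Suc i \<le> n"
  shows "d (Suc n) (Suc i) (t (Suc n) f) = t n (d (Suc n) i f)"
proof -
  have i': "i \<le> n" using i by simp
  note tf = cyclic_closed[OF f] and di = inner_face_closed[OF f i']
  show ?thesis
  proof (rule cochain_eq_splitI[OF inner_face_closed[OF tf i] cyclic_closed[OF di] i])
    fix us0 vs :: "'c list" and c
    assume us0: "length us0 = Suc i" "length us0 + length vs = n"
    then obtain b us where us: "us0 = b # us" "length us = i" by (auto simp: length_Suc_conv)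
    have "d (Suc n) (Suc i) (t (Suc n) f) (pure sC (us0 @ c # vs))
        = swC (\<lambda>x y. \<alpha> (\<lambda>h. f (pure sC ((us @ x # y # vs) @ [actC h b])))) c"
      using inner_face_pure[OF tf us0] cyclic_pure[OF f, of "us @ _ # _ # vs"] us us0 by simp
    also have "\<dots> = \<alpha> (\<lambda>h. swC (\<lambda>x y. f (pure sC ((us @ x # y # vs) @ [actC h b]))) c)"
      by (intro M.MC.contra_sweedler[symmetric] cochain_linear_last[OF f] C.CM.act_linear_left) (use us us0 in simp)
    also have "\<dots> = t n (d (Suc n) i f) (pure sC (us0 @ c # vs))"
      using cyclic_pure[OF di, of "us @ c # vs" b] inner_face_pure[OF f us(2), of "vs @ [_]"] us us0 by simp
    finally show "d (Suc n) (Suc i) (t (Suc n) f) (pure sC (us0 @ c # vs)) = t n (d (Suc n) i f) (pure sC (us0 @ c # vs))" .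
  qed
qed

lemma degen_cyclic_eq:
  assumes f: "f \<in> X n" and i: "Suc i \<le> n"
  shows "s n (Suc i) (t n f) = t (Suc n) (s n i f)"
proof -
  have i': "i \<le> n" using i by simp
  note tf = cyclic_closed[OF f] and si = degen_closed[OF f i']
  show ?thesis
  proof (rule cochain_eq_splitI[where i = "Suc (Suc i)", OF degen_closed[OF tf i] cyclic_closed[OF si]])
    fix us0 vs :: "'c list" and c
    assume us0: "length us0 = Suc (Suc i)" "length us0 + length vs = Suc n"
    then obtain b us where us: "us0 = b # us" "length us = Suc i" by (auto simp: length_Suc_conv)
    have len: "length (us @ vs) = n" using us us0 by simp
    have "s n (Suc i) (t n f) (pure sC (us0 @ c # vs)) = sM (\<epsilon>C c) (\<alpha> (\<lambda>h. f (pure sC ((us @ vs) @ [actC h b]))))"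
      using degen_pure[OF tf us0] cyclic_pure[OF f len, of b] us by simp
    also have "\<dots> = \<alpha> (\<lambda>h. sM (\<epsilon>C c) (f (pure sC ((us @ vs) @ [actC h b]))))"
      by (rule M.MC.contra_scale[OF cochain_linear_last[OF f C.CM.act_linear_left len], symmetric])
    also have "\<dots> = t (Suc n) (s n i f) (pure sC (us0 @ c # vs))"
      using cyclic_pure[OF si, of "us @ c # vs" b] degen_pure[OF f us(2), of "vs @ [_]"] us us0 by simp
    finally show "s n (Suc i) (t n f) (pure sC (us0 @ c # vs)) = t (Suc n) (s n i f) (pure sC (us0 @ c # vs))" .
  qed (use i in simp)
qed

text \<open>Two cyclic steps put the letter that \<open>s\<^sub>0\<close> deletes at the end, where \<open>s\<^sub>n\<close> deletes it; the Sweedler factor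
acting on it is absorbed by the counit.\<close>

lemma degen_zero_cyclic_eq:
  assumes f: "f \<in> X n"
  shows "s n 0 (t n f) = t (Suc n) (t (Suc n) (s n n f))"
proof -
  note tf = cyclic_closed[OF f] and sn = degen_closed[OF f le_refl]
  show ?thesis
  proof (rule cochain_eq_splitI[where i = 1, OF degen_closed[OF tf] cyclic_closed[OF cyclic_closed[OF sn]]])
    fix us cs :: "'c list" and c
    assume us: "length us = 1" "length us + length cs = Suc n"
    then obtain b where b: "us = [b]" by (auto simp: length_Suc_conv)
    have len: "length cs = n" using us by simp
    let ?g = "\<lambda>h. f (pure sC (cs @ [actC h b]))"
    have lin: "Vector_Spaces.linear sH sM ?g" by (rule cochain_linear_last[OF f C.CM.act_linear_left len])
    have "t (Suc n) (t (Suc n) (s n n f)) (pure sC (b # c # cs))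
        = \<alpha> (swH (\<lambda>h k. s n n f (pure sC (cs @ [actC h b, actC k c]))))"
      by (rule cyclic_twice_pure[OF sn len])
    also have "(swH (\<lambda>h k. s n n f (pure sC (cs @ [actC h b, actC k c])))) = (\<lambda>x. sM (\<epsilon>C c) (?g x))"
    proof
      fix x
      have "swH (\<lambda>h k. s n n f (pure sC (cs @ [actC h b, actC k c]))) x = swH (\<lambda>h k. sM (\<epsilon>H k) (sM (\<epsilon>C c) (?g h))) x"
        using degen_pure[OF f, of "cs @ [_]" n "[]"] len by (intro sweedler_cong) (simp add: C.counit_act)
      also have "\<dots> = sM (\<epsilon>C c) (?g x)"
        by (rule C.H.sweedler_counit_right[OF linear_scaled[OF lin]])
      finally show "swH (\<lambda>h k. s n n f (pure sC (cs @ [actC h b, actC k c]))) x = sM (\<epsilon>C c) (?g x)" .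
    qed
    also have "\<alpha> (\<lambda>x. sM (\<epsilon>C c) (?g x)) = sM (\<epsilon>C c) (\<alpha> ?g)" by (rule M.MC.contra_scale[OF lin])
    also have "\<dots> = s n 0 (t n f) (pure sC (us @ c # cs))"
      using degen_pure[OF tf, of us 0 cs c] cyclic_pure[OF f len, of b] b len by simp
    finally show "s n 0 (t n f) (pure sC (us @ c # cs)) = t (Suc n) (t (Suc n) (s n n f)) (pure sC (us @ c # cs))"
      by (simp add: b)
  qed simp_all
qed

section \<open>Identities involving the last face\<close>

text \<open>Comultiplying a letter and applying two cyclic steps lets both Sweedler factors of the free argument
act on \<open>\<Delta>\<^sub>C(c)\<close>. In a module coalgebra this is \<open>\<Delta>\<^sub>C\<close> of the letter acted on, as on the other side.\<close>

lemma last_face_cyclic: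
  assumes f: "f \<in> X (Suc n)"
  shows "d (Suc n) (Suc n) (t (Suc n) f) = t n (d (Suc n) n f)"
proof -
  note tf = cyclic_closed[OF f] and dn = inner_face_closed[OF f le_refl]
  have "d (Suc n) 0 (t (Suc n) (t (Suc n) f)) = t n (d (Suc n) n f)"
  proof (rule cochain_eq_splitI[where i = 0, OF inner_face_closed[OF cyclic_closed[OF tf]] cyclic_closed[OF dn]])
    fix us cs :: "'c list" and c
    assume "length us = 0" "length us + length cs = n"
    then have us: "us = []" and len: "length cs = n" by simp_all
    let ?g = "\<lambda>x y. f (pure sC (cs @ [x, y]))"
    have lin1: "Vector_Spaces.linear sC sM (\<lambda>x. ?g x y)" "Vector_Spaces.linear sC sM (?g x)" for x y
      using cochain_linear[OF f linear_identity[OF vector_space_C], of cs "[y]"] cochain_linear[OF f linear_identity[OF vector_space_C], of "cs @ [x]" "[]"] len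
      by simp_all
    have lin2: "Vector_Spaces.linear sH sM (\<lambda>h. ?g (actC h a) y)" "Vector_Spaces.linear sH sM (\<lambda>h. ?g y (actC h a))" for a y
      using linear_comp[OF lin1(1) C.CM.act_linear_left] linear_comp[OF lin1(2) C.CM.act_linear_left] by blast+
    have "d (Suc n) 0 (t (Suc n) (t (Suc n) f)) (pure sC ([] @ c # cs))
        = swC (\<lambda>a b. \<alpha> (swH (\<lambda>h k. ?g (actC h a) (actC k b)))) c"
      by (subst inner_face_pure[OF cyclic_closed[OF tf]]) (simp_all add: len cyclic_twice_pure[OF f len])
    also have "\<dots> = \<alpha> (\<lambda>x. swC (\<lambda>a b. swH (\<lambda>h k. ?g (actC h a) (actC k b)) x) c)"
      by (intro M.MC.contra_sweedler[symmetric] C.H.linear_sweedler_self vector_space_M lin2)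
    also have "\<dots> = \<alpha> (\<lambda>x. swH (\<lambda>h k. swC (\<lambda>a b. ?g (actC h a) (actC k b)) c) x)"
      by (subst sweedler_swap[OF vector_space_M]) simp
    also have "\<dots> = \<alpha> (\<lambda>x. swC ?g (actC x c))"
      by (simp only: sweedler_comult_act[OF lin1])
    also have "\<dots> = t n (d (Suc n) n f) (pure sC (c # cs))"
      using cyclic_pure[OF dn len, of c] inner_face_pure[OF f len, of "[]"] len by simp
    finally show "d (Suc n) 0 (t (Suc n) (t (Suc n) f)) (pure sC (us @ c # cs)) = t n (d (Suc n) n f) (pure sC (us @ c # cs))"
      by (simp add: us)
  qed simp_all
  then show ?thesis by (simp add: last_face_eq[OF tf])
qed

lemma face_cyclic_eq:
  assumes "f \<in> X (Suc n)" "i \<le> n"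
  shows "d (Suc n) (Suc i) (t (Suc n) f) = t n (d (Suc n) i f)"
  using assms inner_face_cyclic last_face_cyclic by (cases "i = n") simp_all

text \<open>With \<open>d\<^sub>n = d\<^sub>0 t\<close> and the rules moving \<open>t\<close> past faces, an identity with a last face becomes one between
inner faces of \<open>t f\<close>, or of \<open>t (t f)\<close> when the other face is the last one of its degree.\<close>

lemma face_face_eq:
  assumes f: "f \<in> X (Suc (Suc n))" and ij: "i < j" "j \<le> Suc (Suc n)"
  shows "d (Suc n) i (d (Suc (Suc n)) j f) = d (Suc n) (j - 1) (d (Suc (Suc n)) i f)"
proof (cases "j = Suc (Suc n)")
  case False
  then show ?thesis using inner_face_face f ij by simp
next
  case True
  let ?t = "t (Suc (Suc n))" and ?t' = "t (Suc n)" and ?d = "d (Suc (Suc n))" and ?d' = "d (Suc n)"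
  note tf = cyclic_closed[OF f]
  show ?thesis
  proof (cases "i = Suc n")
    case False
    then have i: "i \<le> n" "i \<le> Suc n" using ij True by simp_all
    have "?d' i (?d (Suc (Suc n)) f) = ?d' i (?d 0 (?t f))" by (simp add: last_face_eq[OF f])
    also have "\<dots> = ?d' 0 (?d (Suc i) (?t f))" using inner_face_face[OF tf, of 0 "Suc i"] i by simp
    also have "\<dots> = ?d' 0 (?t' (?d i f))" by (simp add: face_cyclic_eq[OF f i(2)])
    also have "\<dots> = ?d' (Suc n) (?d i f)" by (simp add: last_face_eq inner_face_closed[OF f i(2)])
    finally show ?thesis by (simp add: True)
  next
    case i: True
    have d0: "?d 0 (?t f) \<in> X (Suc n)" by (rule inner_face_closed[OF tf]) simp
    have "?d' (Suc n) (?d (Suc (Suc n)) f) = ?d' 0 (?t' (?d 0 (?t f)))"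
      by (simp add: last_face_eq[OF f] last_face_eq[OF d0])
    also have "\<dots> = ?d' 0 (?d 1 (?t (?t f)))" using face_cyclic_eq[OF tf, of 0] by simp
    also have "\<dots> = ?d' 0 (?d 0 (?t (?t f)))" using inner_face_face[OF cyclic_closed[OF tf], of 0 1] by simp
    also have "\<dots> = ?d' 0 (?t' (?d (Suc n) f))"
      by (simp add: face_cyclic_eq[OF f] flip: last_face_eq[OF tf])
    also have "\<dots> = ?d' (Suc n) (?d (Suc n) f)" by (simp add: last_face_eq inner_face_closed[OF f])
    finally show ?thesis by (simp add: True i)
  qed
qed

lemma face_degen_greater_eq:
  assumes f: "f \<in> X (Suc n)" and ij: "Suc j < i" "i \<le> Suc (Suc n)"
  shows "d (Suc (Suc n)) i (s (Suc n) j f) = s n j (d (Suc n) (i - 1) f)"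
proof (cases "i = Suc (Suc n)")
  case False
  then show ?thesis using inner_face_degen_greater_eq f ij by simp
next
  case True
  then have j: "j \<le> n" "Suc j \<le> Suc n" "j \<le> Suc n" using ij by simp_all
  have "d (Suc (Suc n)) (Suc (Suc n)) (s (Suc n) j f) = d (Suc (Suc n)) 0 (s (Suc n) (Suc j) (t (Suc n) f))"
    by (simp add: last_face_eq degen_closed[OF f j(3)] degen_cyclic_eq[OF f j(2)])
  also have "\<dots> = s n j (d (Suc n) 0 (t (Suc n) f))"
    using face_degen_less_eq[OF cyclic_closed[OF f], of 0 "Suc j"] j by simp
  also have "\<dots> = s n j (d (Suc n) (Suc n) f)" by (simp add: last_face_eq[OF f])
  finally show ?thesis by (simp add: True)
qed

text \<open>In \<open>d\<^sub>0 t s\<^sub>n\<close> the deleted letter is \<open>h c\<^sub>(\<^sub>1\<^sub>)\<close> with \<open>h\<close> the free argument. Its counit splits; the part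
depending on \<open>h\<close> is removed by the unit axiom of the contramodule and the other by the counit of \<open>C\<close>.\<close>

lemma last_face_degen:
  assumes f: "f \<in> X n"
  shows "d (Suc n) (Suc n) (s n n f) = f"
proof -
  note sn = degen_closed[OF f le_refl]
  have "d (Suc n) 0 (t (Suc n) (s n n f)) = f"
  proof (rule cochain_eq_splitI[where i = 0, OF inner_face_closed[OF cyclic_closed[OF sn]] f])
    fix us cs :: "'c list" and c
    assume "length us = 0" "length us + length cs = n"
    then have us: "us = []" and len: "length cs = n" by simp_all
    have "t (Suc n) (s n n f) (pure sC (a # b # cs)) = sM (\<epsilon>C a) (f (pure sC (b # cs)))" for a b
    proof -
      have "t (Suc n) (s n n f) (pure sC (a # b # cs)) = \<alpha> (\<lambda>h. sM (\<epsilon>H h) (sM (\<epsilon>C a) (f (pure sC (b # cs)))))"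
        using cyclic_pure[OF sn, of "b # cs" a] degen_pure[OF f, of "b # cs" n "[]"] len by (simp add: C.counit_act)
      then show ?thesis by (simp only: M.MC.contra_unit)
    qed
    then have "d (Suc n) 0 (t (Suc n) (s n n f)) (pure sC ([] @ c # cs)) = swC (\<lambda>a b. sM (\<epsilon>C a) (f (pure sC (b # cs)))) c"
      by (subst inner_face_pure[OF cyclic_closed[OF sn]]) (simp_all add: len)
    also have "\<dots> = f (pure sC (c # cs))"
      by (rule C.C.sweedler_counit_left) (use cochain_linear[OF f linear_identity[OF vector_space_C], of "[]" cs] len in simp)
    finally show "d (Suc n) 0 (t (Suc n) (s n n f)) (pure sC (us @ c # cs)) = f (pure sC (us @ c # cs))"
      by (simp add: us)
  qed simp_all
  then show ?thesis by (simp add: last_face_eq[OF sn])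
qed

theorem cyclic_module_cochains: "cyclic_module (pointwise_scale sM) X d s t"
proof (intro cyclic_module.intro cyclic_module_axioms.intro vector_space_pointwise)
  interpret P: vector_space "pointwise_scale sM :: 'k \<Rightarrow> (('k, 'c) tensor \<Rightarrow> 'm) \<Rightarrow> _"
    by (rule vector_space_pointwise)
  fix n i j :: nat and x y :: "('k, 'c) tensor \<Rightarrow> 'm" and c
  show "module.subspace (pointwise_scale sM) (X n)"
    by (rule P.subspaceI) (simp_all add: cochain_zero cochain_add cochain_scale)
  show "x \<in> X n \<Longrightarrow> t n x \<in> X n" by (rule cyclic_closed)
  show "x \<in> X n \<Longrightarrow> y \<in> X n \<Longrightarrow> t n (x + y) = t n x + t n y" by (rule cyclic_plus)
  show "x \<in> X n \<Longrightarrow> t n (pointwise_scale sM c x) = pointwise_scale sM c (t n x)" by (rule cyclic_scale)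
  show "j \<le> n \<Longrightarrow> x \<in> X n \<Longrightarrow> s n j x \<in> X (n + 1)" by (simp add: degen_closed)
  show "j \<le> n \<Longrightarrow> x \<in> X n \<Longrightarrow> y \<in> X n \<Longrightarrow> s n j (x + y) = s n j x + s n j y" by (simp add: degen_plus)
  show "j \<le> n \<Longrightarrow> x \<in> X n \<Longrightarrow> s n j (pointwise_scale sM c x) = pointwise_scale sM c (s n j x)" by (simp add: degen_scale)
  show "1 \<le> n \<Longrightarrow> i \<le> n \<Longrightarrow> x \<in> X n \<Longrightarrow> d n i x \<in> X (n - 1)"
    by (cases n) (simp_all add: face_closed)
  show "1 \<le> n \<Longrightarrow> i \<le> n \<Longrightarrow> x \<in> X n \<Longrightarrow> y \<in> X n \<Longrightarrow> d n i (x + y) = d n i x + d n i y"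
    by (cases n) (simp_all add: face_plus)
  show "1 \<le> n \<Longrightarrow> i \<le> n \<Longrightarrow> x \<in> X n \<Longrightarrow> d n i (pointwise_scale sM c x) = pointwise_scale sM c (d n i x)"
    by (cases n) (simp_all add: face_scale)
  show "d (n - 1) i (d n j x) = d (n - 1) (j - 1) (d n i x)" if n: "2 \<le> n" and ij: "i < j" "j \<le> n" and x: "x \<in> X n"
  proof -
    obtain m where "n = Suc (Suc m)" using le_Suc_ex[OF n] by auto
    then show ?thesis using ij x face_face_eq[of x m i j] by simp
  qed
  show "i \<le> j \<Longrightarrow> j \<le> n \<Longrightarrow> x \<in> X n \<Longrightarrow> s (n + 1) i (s n j x) = s (n + 1) (j + 1) (s n i x)"
    by (simp add: degen_degen_eq)
  show "i < j \<Longrightarrow> j \<le> n \<Longrightarrow> x \<in> X n \<Longrightarrow> d (n + 1) i (s n j x) = s (n - 1) (j - 1) (d n i x)"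
    by (cases n) (simp_all add: face_degen_less_eq)
  show "j \<le> n \<Longrightarrow> x \<in> X n \<Longrightarrow> d (n + 1) j (s n j x) = x" by (simp add: face_degen_same_eq)
  show "j \<le> n \<Longrightarrow> x \<in> X n \<Longrightarrow> d (n + 1) (j + 1) (s n j x) = x"
    using inner_face_degen_succ_eq[of x n j] last_face_degen[of x n] by (cases "j = n") simp_all
  show "j + 1 < i \<Longrightarrow> i \<le> n + 1 \<Longrightarrow> x \<in> X n \<Longrightarrow> d (n + 1) i (s n j x) = s (n - 1) j (d n (i - 1) x)"
    by (cases n) (simp_all add: face_degen_greater_eq)
  show "1 \<le> i \<Longrightarrow> i \<le> n \<Longrightarrow> x \<in> X n \<Longrightarrow> d n i (t n x) = t (n - 1) (d n (i - 1) x)"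
    using face_cyclic_eq[of x "n - 1" "i - 1"] by (cases n; cases i) simp_all
  show "1 \<le> n \<Longrightarrow> x \<in> X n \<Longrightarrow> d n 0 (t n x) = d n n x"
    by (cases n) (simp_all add: last_face_eq)
  show "1 \<le> i \<Longrightarrow> i \<le> n \<Longrightarrow> x \<in> X n \<Longrightarrow> s n i (t n x) = t (n + 1) (s n (i - 1) x)"
    using degen_cyclic_eq[of x n "i - 1"] by simp
  show "x \<in> X n \<Longrightarrow> s n 0 (t n x) = (t (n + 1) ^^ 2) (s n n x)"
    by (simp add: degen_zero_cyclic_eq numeral_2_eq_2)
  show "x \<in> X n \<Longrightarrow> (t n ^^ (n + 1)) x = x"
    using cyclic_power_id[of x n] by simp
qed

end

theorem theorem1:
  fixes sH :: "'k::field \<Rightarrow> 'h::ring_1 \<Rightarrow> 'h"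
    and \<Delta>H :: "'h \<Rightarrow> ('k, 'h) tensor"
    and \<epsilon>H :: "'h \<Rightarrow> 'k"
    and S :: "'h \<Rightarrow> 'h"
    and sC :: "'k \<Rightarrow> 'c::ab_group_add \<Rightarrow> 'c"
    and \<Delta>C :: "'c \<Rightarrow> ('k, 'c) tensor"
    and \<epsilon>C :: "'c \<Rightarrow> 'k"
    and actC :: "'h \<Rightarrow> 'c \<Rightarrow> 'c"
    and sM :: "'k \<Rightarrow> 'm::ab_group_add \<Rightarrow> 'm"
    and actM :: "'h \<Rightarrow> 'm \<Rightarrow> 'm"
    and \<alpha> :: "('h \<Rightarrow> 'm) \<Rightarrow> 'm"
  assumes "hopf_algebra sH \<Delta>H \<epsilon>H S"
    and "bij S"
    and "module_coalgebra sH \<Delta>H \<epsilon>H S sC \<Delta>C \<epsilon>C actC"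
    and "stable_ayd_contramodule sH \<Delta>H \<epsilon>H S sM actM \<alpha>"
  shows
    "(\<forall>n i f cs. 1 \<le> n \<longrightarrow> i \<le> n \<longrightarrow> f \<in> cochains sH \<Delta>H sC actC sM actM n \<longrightarrow> length cs = n \<longrightarrow>
        face sC \<Delta>C actC sM \<alpha> n i f (pure sC cs) = face_formula sC \<Delta>C actC sM \<alpha> n i f cs) \<and>
     (\<forall>n j f cs. j \<le> n \<longrightarrow> f \<in> cochains sH \<Delta>H sC actC sM actM n \<longrightarrow> length cs = n + 2 \<longrightarrow>
        degen sC \<epsilon>C sM n j f (pure sC cs) = degen_formula sC \<epsilon>C sM j f cs) \<and>
     (\<forall>n f cs. f \<in> cochains sH \<Delta>H sC actC sM actM n \<longrightarrow> length cs = n + 1 \<longrightarrow>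
        cyclic_op sC actC sM \<alpha> n f (pure sC cs) = cyclic_formula sC actC \<alpha> f cs) \<and>
     cyclic_module (pointwise_scale sM) (cochains sH \<Delta>H sC actC sM actM)
       (face sC \<Delta>C actC sM \<alpha>) (degen sC \<epsilon>C sM) (cyclic_op sC actC sM \<alpha>)"
proof -
  interpret contramodule_cochains sH \<Delta>H \<epsilon>H S sC \<Delta>C \<epsilon>C actC sM actM \<alpha>
    using assms(3,4) by (rule contramodule_cochains.intro)
  show ?thesis
  proof (intro conjI allI impI)
    fix n i :: nat and f and cs :: "'c list"
    assume "1 \<le> n" "i \<le> n" "f \<in> X n" "length cs = n"
    then show "d n i f (pure sC cs) = face_formula sC \<Delta>C actC sM \<alpha> n i f cs"
      unfolding face_def
      by (cases n) (simp_all add: tensor_fun_pure[OF vector_space_M face_multilinear])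
  next
    fix n j :: nat and f and cs :: "'c list"
    assume "j \<le> n" "f \<in> X n" "length cs = n + 2"
    then show "s n j f (pure sC cs) = degen_formula sC \<epsilon>C sM j f cs"
      unfolding degen_def by (simp add: tensor_fun_pure[OF vector_space_M degen_multilinear])
  next
    fix n :: nat and f and cs :: "'c list"
    assume "f \<in> X n" "length cs = n + 1"
    then show "t n f (pure sC cs) = cyclic_formula sC actC \<alpha> f cs"
      unfolding cyclic_op_def by (simp add: tensor_fun_pure[OF vector_space_M cyclic_multilinear])
  next
    show "cyclic_module (pointwise_scale sM) X d s t" by (rule cyclic_module_cochains)
  qed
qed

end
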